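(* Let $q$ be a prime power, and let $C,R\in\mathbb{Q}$ with $C>0$. For $n\in\mathbb{N}$ put $m=m(n)=\lceil Cn+R\rceil$, and let $V\cong\mathbb{F}_q^n$, $W\cong\mathbb{F}_q^m$. Then there exist constants $c>0$ and $n_0$ (independent of $n$) such that for all $n\ge n_0$ each of $h(n,m,q)$, $h_{\mathrm{S}}(n,m,q)$ and $h_\Lambda(n,m,q)$ is at most $q-1+q^{-cn^2}$.
   Context: A bilinear map $\varphi:V\times V\to W$ is symmetric if $\varphi(v_1,v_2)=\varphi(v_2,v_1)$ for all $v_1,v_2$, and alternating if $\varphi(v,v)=0$ for all $v$. The group $\mathrm{GL}(V)\times\mathrm{GL}(W)$ acts on bilinear maps by $[(P,Q)\circ\varphi](v_1,v_2)=Q^{-1}(\varphi(P v_1,P v_2))$. Let $\mathrm{Aut}(\varphi)=\{(P,Q)\in\mathrm{GL}(V)\times\mathrm{GL}(W)\mid (P,Q)\circ\varphi=\varphi\}$. Define $h(n,m,q)$ as the average of $|\mathrm{Aut}(\varphi)|$ over all bilinear maps $\varphi:V\times V\to W$, i.e. $\sum_{\varphi}|\mathrm{Aut}(\varphi)|$ divided by the number of bilinear maps $V\times V\to W$; $h_{\mathrm{S}}(n,m,q)$ and $h_\Lambda(n,m,q)$ are the same averages taken over all symmetric, respectively all alternating, bilinear maps $V\times V\to W$. *)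

theory Defs
  imports "Jordan_Normal_Form.VS_Connect" "HOL-Library.FuncSet" "HOL-Library.Cardinality"
begin

text \<open>Maps are taken extensional (undefined outside their domain), so that each map between
  carriers is represented by exactly one HOL function and \<open>card\<close> counts maps correctly.\<close>

definition bilinear_maps ::
  "('k, 'r) ring_scheme \<Rightarrow> ('k, 'v, 's) module_scheme \<Rightarrow> ('k, 'w, 't) module_scheme \<Rightarrow> ('v \<times> 'v \<Rightarrow> 'w) set"
  where
  "bilinear_maps K V W =
    {\<phi> \<in> extensional (carrier V \<times> carrier V).
      (\<forall>v\<in>carrier V. (\<lambda>u. \<phi> (u, v)) \<in> LinearCombinations.module_hom K V W) \<and>
      (\<forall>u\<in>carrier V. (\<lambda>v. \<phi> (u, v)) \<in> LinearCombinations.module_hom K V W)}"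

definition symmetric_maps ::
  "('k, 'r) ring_scheme \<Rightarrow> ('k, 'v, 's) module_scheme \<Rightarrow> ('k, 'w, 't) module_scheme \<Rightarrow> ('v \<times> 'v \<Rightarrow> 'w) set"
  where
  "symmetric_maps K V W =
    {\<phi> \<in> bilinear_maps K V W. \<forall>v1\<in>carrier V. \<forall>v2\<in>carrier V. \<phi> (v1, v2) = \<phi> (v2, v1)}"

definition alternating_maps ::
  "('k, 'r) ring_scheme \<Rightarrow> ('k, 'v, 's) module_scheme \<Rightarrow> ('k, 'w, 't) module_scheme \<Rightarrow> ('v \<times> 'v \<Rightarrow> 'w) set"
  where
  "alternating_maps K V W =
    {\<phi> \<in> bilinear_maps K V W. \<forall>v\<in>carrier V. \<phi> (v, v) = \<zero>\<^bsub>W\<^esub>}"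

definition GL :: "('k, 'r) ring_scheme \<Rightarrow> ('k, 'v, 's) module_scheme \<Rightarrow> ('v \<Rightarrow> 'v) set" where
  "GL K V =
    {P \<in> extensional (carrier V) \<inter> LinearCombinations.module_hom K V V.
      bij_betw P (carrier V) (carrier V)}"

definition bilinear_act ::
  "('k, 'v, 's) module_scheme \<Rightarrow> ('k, 'w, 't) module_scheme \<Rightarrow>
    ('v \<Rightarrow> 'v) \<times> ('w \<Rightarrow> 'w) \<Rightarrow> ('v \<times> 'v \<Rightarrow> 'w) \<Rightarrow> 'v \<times> 'v \<Rightarrow> 'w" where
  "bilinear_act V W = (\<lambda>(P, Q) \<phi>.
    (\<lambda>(v1, v2) \<in> carrier V \<times> carrier V. inv_into (carrier W) Q (\<phi> (P v1, P v2))))"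

definition bilinear_Aut ::
  "('k, 'r) ring_scheme \<Rightarrow> ('k, 'v, 's) module_scheme \<Rightarrow> ('k, 'w, 't) module_scheme \<Rightarrow>
    ('v \<times> 'v \<Rightarrow> 'w) \<Rightarrow> (('v \<Rightarrow> 'v) \<times> ('w \<Rightarrow> 'w)) set" where
  "bilinear_Aut K V W \<phi> = {PQ \<in> GL K V \<times> GL K W. bilinear_act V W PQ \<phi> = \<phi>}"

definition average_Aut ::
  "('k, 'r) ring_scheme \<Rightarrow> ('k, 'v, 's) module_scheme \<Rightarrow> ('k, 'w, 't) module_scheme \<Rightarrow>
    ('v \<times> 'v \<Rightarrow> 'w) set \<Rightarrow> real" where
  "average_Aut K V W B = (\<Sum>\<phi>\<in>B. real (card (bilinear_Aut K V W \<phi>))) / real (card B)"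

text \<open>The averages depend on \<open>V\<close> and \<open>W\<close> only up to isomorphism, so they are taken over the
  coordinate spaces of dimensions \<open>n\<close> and \<open>m\<close>; the prime power \<open>q\<close> enters through the
  field \<open>'a\<close> with \<open>q = CARD('a)\<close>.\<close>

definition h :: "'a::{field,finite} itself \<Rightarrow> nat \<Rightarrow> nat \<Rightarrow> real" where
  "h ty n m = (let K = (class_ring :: 'a ring); V = module_vec ty n; W = module_vec ty m
    in average_Aut K V W (bilinear_maps K V W))"

definition h_S :: "'a::{field,finite} itself \<Rightarrow> nat \<Rightarrow> nat \<Rightarrow> real" where
  "h_S ty n m = (let K = (class_ring :: 'a ring); V = module_vec ty n; W = module_vec ty m
    in average_Aut K V W (symmetric_maps K V W))"

definition h_Alt :: "'a::{field,finite} itself \<Rightarrow> nat \<Rightarrow> nat \<Rightarrow> real" where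
  "h_Alt ty n m = (let K = (class_ring :: 'a ring); V = module_vec ty n; W = module_vec ty m
    in average_Aut K V W (alternating_maps K V W))"

end

theory Submission
  imports Defs
begin

text \<open>Counting pairs, the average is the sum over all pairs \<open>(P, Q)\<close> of the proportion of forms that
  are fixed by \<open>(P, Q)\<close>, so it suffices to bound that proportion and the number of pairs.
  Fix a constant \<open>k\<close> of order \<open>C + 1/C\<close>.
  If \<open>V\<close> contains \<open>v\<^sub>1, \<dots>, v\<^sub>k\<close> such that the \<open>2k\<close> vectors \<open>v\<^sub>i\<close>, \<open>P v\<^sub>i\<close> are independent, then the
  proportion is at most \<open>q\<close> to the power \<open>- k (n - 2k) m\<close>, which outweighs the number of all pairs.
  Otherwise \<open>P\<close> differs from a scalar \<open>a\<close> by a map of rank less than \<open>2k\<close>, which leaves only \<open>q\<close> to the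
  power \<open>O(n)\<close> many \<open>P\<close>. A fixed form maps pairs of \<open>a\<close>-eigenvectors of \<open>P\<close> to \<open>a\<^sup>2\<close>-eigenvectors of \<open>Q\<close>,
  so if \<open>Q - a\<^sup>2\<close> has rank \<open>s > 0\<close>, the proportion is at most \<open>q\<close> to the power \<open>- s n\<^sup>2 / 2 + O(s n)\<close>, which
  outweighs the \<open>q\<close> to the power \<open>O(s n)\<close> many \<open>Q\<close>. If \<open>Q = a\<^sup>2\<close> and \<open>P\<close> is not scalar, the first bound
  with \<open>k = 1\<close> suffices. What remains are the \<open>q - 1\<close> pairs \<open>(a, a\<^sup>2)\<close>, which fix every form.\<close>

section \<open>Linear maps and dual systems\<close>

text \<open>\<open>module_hom\<close> between coordinate spaces, unfolded to plain vector
  operations; \<open>module_hom_vec_iff\<close> is the bridge to the notions above.\<close>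

definition linear_vec :: "nat \<Rightarrow> nat \<Rightarrow> ('a::field vec \<Rightarrow> 'a vec) \<Rightarrow> bool" where
  "linear_vec n m f \<longleftrightarrow> f \<in> carrier_vec n \<rightarrow> carrier_vec m \<and>
    (\<forall>x\<in>carrier_vec n. \<forall>y\<in>carrier_vec n. f (x + y) = f x + f y) \<and>
    (\<forall>a. \<forall>x\<in>carrier_vec n. f (a \<cdot>\<^sub>v x) = a \<cdot>\<^sub>v f x)"

lemma linear_vecD:
  assumes "linear_vec n m f" and "x \<in> carrier_vec n"
  shows "f x \<in> carrier_vec m"
    and "y \<in> carrier_vec n \<Longrightarrow> f (x + y) = f x + f y"
    and "f (a \<cdot>\<^sub>v x) = a \<cdot>\<^sub>v f x"
  using assms unfolding linear_vec_def by auto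

lemma module_hom_vec_iff:
  "f \<in> LinearCombinations.module_hom (class_ring :: 'a::field ring) (module_vec TYPE('a) n) (module_vec TYPE('a) m)
    \<longleftrightarrow> linear_vec n m f"
  unfolding LinearCombinations.module_hom_def linear_vec_def
  by (auto simp: module_vec_simps)

lemma linear_vec_zero:
  assumes "linear_vec n m f"
  shows "f (0\<^sub>v n) = (0\<^sub>v m :: 'a::field vec)"
proof -
  have "f (0 \<cdot>\<^sub>v 0\<^sub>v n) = 0 \<cdot>\<^sub>v f (0\<^sub>v n)"
    using linear_vecD(3)[OF assms] by simp
  moreover have "f (0\<^sub>v n) \<in> carrier_vec m"
    using linear_vecD(1)[OF assms] by simp
  moreover have "0 \<cdot>\<^sub>v v = 0\<^sub>v k" if "v \<in> carrier_vec k" for k and v :: "'a vec"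
    using that by (intro eq_vecI) auto
  ultimately show ?thesis by (metis zero_carrier_vec)
qed

text \<open>Defined coordinatewise in a prescribed dimension, so the result lies in
  \<open>carrier_vec n\<close> for every family \<open>X\<close>, and only the first
  \<open>r\<close> members count.\<close>

definition lin_comb :: "nat \<Rightarrow> nat \<Rightarrow> (nat \<Rightarrow> 'a::field) \<Rightarrow> (nat \<Rightarrow> 'a vec) \<Rightarrow> 'a vec" where
  "lin_comb n r c X = vec n (\<lambda>t. \<Sum>i<r. c i * X i $ t)"

lemma lin_comb_carrier [simp]: "lin_comb n r c X \<in> carrier_vec n"
  by (simp add: lin_comb_def)

lemma dim_lin_comb [simp]: "dim_vec (lin_comb n r c X) = n"
  by (simp add: lin_comb_def)

lemma index_lin_comb [simp]: "t < n \<Longrightarrow> lin_comb n r c X $ t = (\<Sum>i<r. c i * X i $ t)"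
  by (simp add: lin_comb_def)

lemma lin_comb_cong:
  assumes "\<And>i. i < r \<Longrightarrow> c i = d i" and "\<And>i. i < r \<Longrightarrow> X i = Y i"
  shows "lin_comb n r c X = lin_comb n r d Y"
  unfolding lin_comb_def by (intro eq_vecI) (auto intro!: sum.cong simp: assms)

lemma lin_comb_Suc:
  assumes "X r \<in> carrier_vec n"
  shows "lin_comb n (Suc r) c X = lin_comb n r c X + c r \<cdot>\<^sub>v X r"
  using assms by (intro eq_vecI) auto

lemma scalar_prod_lin_comb:
  assumes "\<And>i. i < r \<Longrightarrow> X i \<in> carrier_vec n"
  shows "y \<bullet> lin_comb n r c X = (\<Sum>i<r. c i * (y \<bullet> X i))"
proof -
  have "y \<bullet> lin_comb n r c X = (\<Sum>t<n. \<Sum>i<r. c i * (y $ t * X i $ t))"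
    by (auto simp: scalar_prod_def sum_distrib_left atLeast0LessThan mult.left_commute intro!: sum.cong)
  also have "\<dots> = (\<Sum>i<r. \<Sum>t<n. c i * (y $ t * X i $ t))"
    by (rule sum.swap)
  also have "\<dots> = (\<Sum>i<r. c i * (y \<bullet> X i))"
  proof (rule sum.cong)
    fix i assume "i \<in> {..<r}"
    then have "dim_vec (X i) = n" using assms by auto
    then show "(\<Sum>t<n. c i * (y $ t * X i $ t)) = c i * (y \<bullet> X i)"
      by (simp add: scalar_prod_def sum_distrib_left atLeast0LessThan)
  qed simp
  finally show ?thesis .
qed

lemma linear_vec_lin_comb:
  assumes f: "linear_vec n m f" and X: "\<And>i. i < r \<Longrightarrow> X i \<in> carrier_vec n"
  shows "f (lin_comb n r c X) = lin_comb m r c (\<lambda>i. f (X i))"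
  using X
proof (induction r)
  case 0
  have "lin_comb k 0 c Z = 0\<^sub>v k" for k and Z :: "nat \<Rightarrow> 'a vec"
    by (intro eq_vecI) auto
  then show ?case using linear_vec_zero[OF f] by simp
next
  case (Suc r)
  then show ?case
    using linear_vecD[OF f] by (simp add: lin_comb_Suc)
qed

lemma lin_comb_unit_vec:
  assumes "v \<in> carrier_vec n"
  shows "lin_comb n n (\<lambda>i. v $ i) (unit_vec n) = v"
  using assms by (intro eq_vecI) (auto simp: if_distrib cong: if_cong)

text \<open>Functionals \<open>Y\<close> biorthogonal to \<open>X\<close> certify that the
  \<open>X i\<close> are independent and compute coordinates in their span. Such certificates,
  together with counting, take the place of bases and dimension.\<close>

definition dual_system :: "nat \<Rightarrow> nat \<Rightarrow> (nat \<Rightarrow> 'a::field vec) \<Rightarrow> (nat \<Rightarrow> 'a vec) \<Rightarrow> bool" where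
  "dual_system n r X Y \<longleftrightarrow> (\<forall>i<r. X i \<in> carrier_vec n \<and> Y i \<in> carrier_vec n) \<and>
    (\<forall>i<r. \<forall>j<r. Y i \<bullet> X j = (if i = j then 1 else 0))"

lemma dual_systemD:
  assumes "dual_system n r X Y" and "i < r"
  shows "X i \<in> carrier_vec n" and "Y i \<in> carrier_vec n"
    and "j < r \<Longrightarrow> Y i \<bullet> X j = (if i = j then 1 else 0)"
  using assms unfolding dual_system_def by auto

lemma dual_system_mono: "dual_system n r X Y \<Longrightarrow> s \<le> r \<Longrightarrow> dual_system n s X Y"
  unfolding dual_system_def by auto

lemma dual_system_coeff:
  assumes "dual_system n r X Y" and "j < r"
  shows "Y j \<bullet> lin_comb n r c X = c j"
proof -
  have "Y j \<bullet> lin_comb n r c X = (\<Sum>i<r. c i * (if j = i then 1 else 0))"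
    using dual_systemD[OF assms(1)] assms(2) by (subst scalar_prod_lin_comb) auto
  also have "\<dots> = c j" using assms(2) by (simp add: if_distrib cong: if_cong)
  finally show ?thesis .
qed

text \<open>The last hypothesis says that \<open>x\<close> differs from its projection to the span
  of \<open>X\<close> along the common kernel of the \<open>Y i\<close>, that is, \<open>x\<close>
  lies outside the span. A coordinate where the two differ yields a functional that vanishes on all
  \<open>X i\<close> but not at \<open>x\<close>.\<close>

lemma dual_system_extend:
  assumes D: "dual_system n r X Y" and x: "x \<in> carrier_vec n"
    and neq: "x \<noteq> lin_comb n r (\<lambda>i. Y i \<bullet> x) X"
  shows "\<exists>Y'. dual_system n (Suc r) (X(r := x)) Y'"
proof -
  define p where "p = lin_comb n r (\<lambda>i. Y i \<bullet> x) X"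
  obtain t where t: "t < n" "x $ t - p $ t \<noteq> 0"
    using neq x unfolding p_def[symmetric]
    by (metis carrier_vecD dim_lin_comb eq_vecI eq_iff_diff_eq_0 p_def)
  define d where "d = x $ t - p $ t"
  \<comment> \<open>the functional \<open>y \<mapsto> (y - \<Sum>i. (Y i \<bullet> y) X i) $ t\<close>, normalised at \<open>x\<close>\<close>
  define \<xi> where "\<xi> = (1 / d) \<cdot>\<^sub>v (unit_vec n t - lin_comb n r (\<lambda>i. X i $ t) Y)"
  have \<xi>: "\<xi> \<in> carrier_vec n" by (simp add: \<xi>_def)
  note DD = dual_systemD[OF D]
  have comm: "y \<bullet> z = z \<bullet> y" if "y \<in> carrier_vec n" "z \<in> carrier_vec n" for y z :: "'a vec"
    using that comm_scalar_prod by blast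
  have ev: "\<xi> \<bullet> y = (1 / d) * (y $ t - (\<Sum>i<r. X i $ t * (Y i \<bullet> y)))" if y: "y \<in> carrier_vec n" for y
  proof -
    have "lin_comb n r (\<lambda>i. X i $ t) Y \<bullet> y = (\<Sum>i<r. X i $ t * (Y i \<bullet> y))"
      using y DD by (subst comm) (auto simp: scalar_prod_lin_comb comm intro!: sum.cong)
    moreover have "unit_vec n t \<bullet> y = y $ t" using y t by simp
    ultimately show ?thesis
      using y unfolding \<xi>_def
      by (simp add: minus_scalar_prod_distrib[of _ n])
  qed
  have \<xi>X: "\<xi> \<bullet> X j = 0" if j: "j < r" for j
  proof -
    have "(\<Sum>i<r. X i $ t * (Y i \<bullet> X j)) = (\<Sum>i<r. X i $ t * (if i = j then 1 else 0))"
      using DD j by (auto intro!: sum.cong)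
    also have "\<dots> = X j $ t" using j by (simp add: if_distrib cong: if_cong)
    finally show ?thesis using ev DD(1)[OF j] by simp
  qed
  have "p $ t = (\<Sum>i<r. X i $ t * (Y i \<bullet> x))"
    using t by (simp add: p_def mult.commute)
  then have \<xi>x: "\<xi> \<bullet> x = 1" using ev[OF x] t by (simp add: d_def)
  \<comment> \<open>Subtracting multiples of \<xi> makes the old functionals vanish at
    \<open>x\<close> and keeps their values on the old vectors.\<close>
  define Y' where "Y' = (\<lambda>i. if i = r then \<xi> else Y i - (Y i \<bullet> x) \<cdot>\<^sub>v \<xi>)"
  have "dual_system n (Suc r) (X(r := x)) Y'"
    unfolding dual_system_def
  proof (intro conjI allI impI)
    fix i assume "i < Suc r"
    then show "(X(r := x)) i \<in> carrier_vec n" "Y' i \<in> carrier_vec n"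
      using DD x \<xi> by (auto simp: Y'_def)
  next
    fix i j assume "i < Suc r" "j < Suc r"
    then consider "i = r" "j = r" | "i = r" "j < r" | "i < r" "j = r" | "i < r" "j < r"
      by linarith
    then show "Y' i \<bullet> (X(r := x)) j = (if i = j then 1 else 0)"
      using DD x \<xi> \<xi>X \<xi>x
      by cases (auto simp: Y'_def minus_scalar_prod_distrib[of _ n])
  qed
  then show ?thesis by blast
qed

section \<open>Counting vectors over a finite field\<close>

lemma carrier_vec_bij:
  "bij_betw (\<lambda>v. \<lambda>i\<in>{..<n}. v $ i) (carrier_vec n) (PiE {..<n} (\<lambda>_. UNIV :: 'a set))"
  by (rule bij_betw_byWitness[where f' = "\<lambda>f. vec n f"])
     (auto simp: fun_eq_iff PiE_def extensional_def)

lemma finite_carrier_vec [simp]: "finite (carrier_vec n :: 'a::finite vec set)"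
  using bij_betw_finite[OF carrier_vec_bij[of n, where 'a = 'a]] by (simp add: finite_PiE)

lemma card_carrier_vec: "card (carrier_vec n :: 'a::finite vec set) = CARD('a) ^ n"
  using bij_betw_same_card[OF carrier_vec_bij[of n, where 'a = 'a]] by (simp add: card_PiE)

lemma card_lin_comb_le:
  "finite (range (\<lambda>c. lin_comb n r c (X :: nat \<Rightarrow> 'a::{field,finite} vec))) \<and>
   card (range (\<lambda>c. lin_comb n r c X)) \<le> CARD('a) ^ r"
proof -
  have "range (\<lambda>c. lin_comb n r c X) \<subseteq> (\<lambda>c. lin_comb n r c X) ` (PiE {..<r} (\<lambda>_. UNIV))" (is "_ \<subseteq> ?R")
  proof safe
    fix c
    have "lin_comb n r c X = lin_comb n r (restrict c {..<r}) X" by (rule lin_comb_cong) auto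
    then show "lin_comb n r c X \<in> ?R" by auto
  qed
  moreover have fin: "finite (PiE {..<r} (\<lambda>_. UNIV :: 'a set))" by (simp add: finite_PiE)
  moreover have "card ?R \<le> CARD('a) ^ r"
    using card_image_le[OF fin] by (simp add: card_PiE)
  ultimately show ?thesis by (meson card_mono finite_imageI finite_subset le_trans)
qed

lemma one_less_card_field: "1 < CARD('a::{field,finite})"
proof -
  have "card {0, 1 :: 'a} \<le> CARD('a)" by (rule card_mono) auto
  then show ?thesis by simp
qed

text \<open>Greedy choice: \<open>d\<close> vectors span at most \<open>q ^ d\<close> elements, so a
  set of at least \<open>q ^ (d + 1)\<close> vectors has a member outside their span. Later
  \<open>S\<close> is the whole space or an eigenspace.\<close>

lemma dual_system_extend_within:
  fixes S :: "'a::{field,finite} vec set"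
  assumes D: "dual_system n r X Y" and S: "S \<subseteq> carrier_vec n"
    and "r \<le> d" and "CARD('a) ^ d \<le> card S"
  shows "\<exists>X' Y'. dual_system n d X' Y' \<and> (\<forall>i<r. X' i = X i) \<and> (\<forall>i. r \<le> i \<and> i < d \<longrightarrow> X' i \<in> S)"
  using assms(3,4)
proof (induction d rule: dec_induct)
  case base
  then show ?case using D by auto
next
  case (step d)
  have q: "1 < CARD('a)" by (rule one_less_card_field)
  have lt: "CARD('a) ^ d < CARD('a) ^ Suc d" using q by simp
  have "CARD('a) ^ d \<le> card S" using lt step.prems by linarith
  from step.IH[OF this] obtain X' Y' where D': "dual_system n d X' Y'"
    and X': "\<forall>i<r. X' i = X i" and S': "\<forall>i. r \<le> i \<and> i < d \<longrightarrow> X' i \<in> S"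
    by blast
  have "\<not> S \<subseteq> range (\<lambda>c. lin_comb n d c X')"
  proof
    assume "S \<subseteq> range (\<lambda>c. lin_comb n d c X')"
    then have "card S \<le> CARD('a) ^ d"
      using card_lin_comb_le[of n d X'] card_mono le_trans by blast
    then show False using step.prems lt by linarith
  qed
  then obtain x where x: "x \<in> S" "x \<notin> range (\<lambda>c. lin_comb n d c X')" by blast
  have "x \<in> carrier_vec n" using x(1) S by (rule subsetD[rotated])
  moreover have "x \<noteq> lin_comb n d (\<lambda>i. Y' i \<bullet> x) X'" using x(2) by (metis rangeI)
  ultimately obtain Y'' where "dual_system n (Suc d) (X'(d := x)) Y''"
    using dual_system_extend[OF D'] by metis
  moreover have "\<forall>i<r. (X'(d := x)) i = X i" using X' step.hyps by auto
  moreover have "\<forall>i. r \<le> i \<and> i < Suc d \<longrightarrow> (X'(d := x)) i \<in> S"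
    using S' x(1) by (auto simp: less_Suc_eq)
  ultimately show ?case by (intro exI conjI)
qed

text \<open>The functionals recover the coefficients, so \<open>q ^ r\<close> distinct combinations
  fit into a space of \<open>q ^ n\<close> elements.\<close>

lemma dual_system_size:
  fixes X :: "nat \<Rightarrow> 'a::{field,finite} vec"
  assumes "dual_system n r X Y"
  shows "r \<le> n"
proof -
  have "inj_on (\<lambda>c. lin_comb n r c X) (PiE {..<r} (\<lambda>_. UNIV))"
  proof (rule inj_onI)
    fix c d :: "nat \<Rightarrow> 'a"
    assume cd: "c \<in> PiE {..<r} (\<lambda>_. UNIV)" "d \<in> PiE {..<r} (\<lambda>_. UNIV)"
      and eq: "lin_comb n r c X = lin_comb n r d X"
    have "c j = d j" if "j < r" for j
      using dual_system_coeff[OF assms that, of c] dual_system_coeff[OF assms that, of d] eq by simp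
    then show "c = d" using cd by (intro PiE_ext) auto
  qed
  then have "CARD('a) ^ r \<le> CARD('a) ^ n"
    using card_inj_on_le[of _ "PiE {..<r} (\<lambda>_. UNIV :: 'a set)" "carrier_vec n :: 'a vec set"]
    by (simp add: card_PiE card_carrier_vec image_subset_iff)
  then show ?thesis using one_less_card_field[where 'a = 'a] by simp
qed

section \<open>Families of bilinear maps\<close>

lemma linear_vec_minus:
  assumes f: "linear_vec n m f" and x: "x \<in> carrier_vec n" and y: "y \<in> carrier_vec n"
  shows "f (x - y) = f x - (f y :: 'a::field vec)"
proof -
  have "f (x - y) = f (x + (- 1) \<cdot>\<^sub>v y)" using x y by (intro arg_cong[where f = f]) auto
  also have "\<dots> = f x + (- 1) \<cdot>\<^sub>v f y" using linear_vecD[OF f] x y by simp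
  also have "\<dots> = f x - f y" using linear_vecD(1)[OF f] x y by auto
  finally show ?thesis .
qed

lemma lin_comb_zero: "(\<And>i. i < r \<Longrightarrow> c i = 0) \<Longrightarrow> lin_comb n r c X = 0\<^sub>v n"
  by (intro eq_vecI) auto

lemma lin_comb_add: "lin_comb n r (\<lambda>i. c i + d i) X = lin_comb n r c X + lin_comb n r d X"
  by (intro eq_vecI) (auto simp: algebra_simps sum.distrib)

lemma lin_comb_diff: "lin_comb n r (\<lambda>i. c i - d i) X = lin_comb n r c X - lin_comb n r d X"
  by (intro eq_vecI) (auto simp: algebra_simps sum_subtractf)

lemma lin_comb_smult: "lin_comb n r (\<lambda>i. a * c i) X = a \<cdot>\<^sub>v lin_comb n r c X"
  by (intro eq_vecI) (auto simp: algebra_simps sum_distrib_left)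

text \<open>For \<epsilon> = 1 and \<epsilon> = -1 this is the symmetrised and the antisymmetrised
  product of the functionals \<open>Y i\<close> and \<open>Y j\<close>.\<close>

definition pair_coeff ::
  "'a::field \<Rightarrow> (nat \<Rightarrow> 'a vec) \<Rightarrow> 'a vec \<Rightarrow> 'a vec \<Rightarrow> nat \<times> nat \<Rightarrow> 'a" where
  "pair_coeff \<epsilon> Y x y = (\<lambda>(i, j). (Y i \<bullet> x) * (Y j \<bullet> y) + \<epsilon> * (Y i \<bullet> y) * (Y j \<bullet> x))"

lemma pair_coeff_add:
  assumes "Y (fst p) \<in> carrier_vec n" "Y (snd p) \<in> carrier_vec n"
    and "x \<in> carrier_vec n" "y \<in> carrier_vec n"
  shows "pair_coeff \<epsilon> Y (x + y) z p = pair_coeff \<epsilon> Y x z p + pair_coeff \<epsilon> Y y z p"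
    and "pair_coeff \<epsilon> Y z (x + y) p = pair_coeff \<epsilon> Y z x p + pair_coeff \<epsilon> Y z y p"
  using assms by (auto simp: pair_coeff_def case_prod_beta scalar_prod_add_distrib[of _ n] algebra_simps)

lemma pair_coeff_smult:
  assumes "Y (fst p) \<in> carrier_vec n" "Y (snd p) \<in> carrier_vec n" and "x \<in> carrier_vec n"
  shows "pair_coeff \<epsilon> Y (a \<cdot>\<^sub>v x) z p = a * pair_coeff \<epsilon> Y x z p"
    and "pair_coeff \<epsilon> Y z (a \<cdot>\<^sub>v x) p = a * pair_coeff \<epsilon> Y z x p"
  using assms by (auto simp: pair_coeff_def case_prod_beta algebra_simps)

text \<open>These are the test forms: products of functionals, with values in the span of the
  vectors \<open>w l\<close>. The \<open>card S * s\<close> coefficients \<open>c (p, l)\<close> are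
  the free parameters that are counted later.\<close>

definition sum_form ::
  "nat \<Rightarrow> nat \<Rightarrow> nat \<Rightarrow> 'a::field \<Rightarrow> (nat \<Rightarrow> 'a vec) \<Rightarrow> (nat \<Rightarrow> 'a vec) \<Rightarrow> (nat \<times> nat) set \<Rightarrow>
    ((nat \<times> nat) \<times> nat \<Rightarrow> 'a) \<Rightarrow> 'a vec \<times> 'a vec \<Rightarrow> 'a vec" where
  "sum_form n m s \<epsilon> Y w S c = (\<lambda>(x, y) \<in> carrier_vec n \<times> carrier_vec n.
    lin_comb m s (\<lambda>l. \<Sum>p\<in>S. pair_coeff \<epsilon> Y x y p * c (p, l)) w)"

lemma sum_form_apply:
  assumes "x \<in> carrier_vec n" and "y \<in> carrier_vec n"
  shows "sum_form n m s \<epsilon> Y w S c (x, y) =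
    lin_comb m s (\<lambda>l. \<Sum>p\<in>S. pair_coeff \<epsilon> Y x y p * c (p, l)) w"
  using assms by (simp add: sum_form_def)

lemma sum_form_carrier:
  assumes "x \<in> carrier_vec n" and "y \<in> carrier_vec n"
  shows "sum_form n m s \<epsilon> Y w S c (x, y) \<in> carrier_vec m"
  using assms by (simp add: sum_form_apply)

lemma sum_form_diff:
  assumes "x \<in> carrier_vec n" and "y \<in> carrier_vec n"
  shows "sum_form n m s \<epsilon> Y w S (\<lambda>p. c p - d p) (x, y) =
    sum_form n m s \<epsilon> Y w S c (x, y) - sum_form n m s \<epsilon> Y w S d (x, y)"
  unfolding sum_form_apply[OF assms] lin_comb_diff[symmetric]
  by (simp only: right_diff_distrib sum_subtractf)

lemma sum_form_linear:
  assumes Y: "\<forall>(i, j)\<in>S. Y i \<in> carrier_vec n \<and> Y j \<in> carrier_vec n"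
    and z: "z \<in> carrier_vec n"
  shows "linear_vec n m (\<lambda>x. sum_form n m s \<epsilon> Y w S c (x, z))"
    and "linear_vec n m (\<lambda>y. sum_form n m s \<epsilon> Y w S c (z, y))"
proof -
  have YS: "Y (fst p) \<in> carrier_vec n" "Y (snd p) \<in> carrier_vec n" if "p \<in> S" for p
    using Y that by auto
  have add: "sum_form n m s \<epsilon> Y w S c (x + y, z) =
      sum_form n m s \<epsilon> Y w S c (x, z) + sum_form n m s \<epsilon> Y w S c (y, z)"
    "sum_form n m s \<epsilon> Y w S c (z, x + y) =
      sum_form n m s \<epsilon> Y w S c (z, x) + sum_form n m s \<epsilon> Y w S c (z, y)"
    if "x \<in> carrier_vec n" "y \<in> carrier_vec n" for x y
    using that z YS
    by (simp_all add: sum_form_apply pair_coeff_add[of _ _ n] flip: lin_comb_add sum.distrib distrib_right)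
  have smult: "sum_form n m s \<epsilon> Y w S c (a \<cdot>\<^sub>v x, z) = a \<cdot>\<^sub>v sum_form n m s \<epsilon> Y w S c (x, z)"
    "sum_form n m s \<epsilon> Y w S c (z, a \<cdot>\<^sub>v x) = a \<cdot>\<^sub>v sum_form n m s \<epsilon> Y w S c (z, x)"
    if "x \<in> carrier_vec n" for x a
    using that z YS
    by (simp_all add: sum_form_apply pair_coeff_smult[of _ _ n] sum_distrib_left mult.assoc flip: lin_comb_smult)
  show "linear_vec n m (\<lambda>x. sum_form n m s \<epsilon> Y w S c (x, z))"
    "linear_vec n m (\<lambda>y. sum_form n m s \<epsilon> Y w S c (z, y))"
    using z unfolding linear_vec_def by (auto simp: add smult sum_form_carrier)
qed

lemma bilinear_maps_vec_iff:
  "\<phi> \<in> bilinear_maps (class_ring :: 'a::field ring) (module_vec TYPE('a) n) (module_vec TYPE('a) m) \<longleftrightarrow>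
    \<phi> \<in> extensional (carrier_vec n \<times> carrier_vec n) \<and>
    (\<forall>v\<in>carrier_vec n. linear_vec n m (\<lambda>u. \<phi> (u, v)) \<and> linear_vec n m (\<lambda>u. \<phi> (v, u)))"
  unfolding bilinear_maps_def by (auto simp: module_vec_simps module_hom_vec_iff)

lemma bilinear_maps_carrier:
  fixes \<phi> :: "'a::field vec \<times> 'a vec \<Rightarrow> 'a vec"
  assumes "\<phi> \<in> bilinear_maps class_ring (module_vec TYPE('a) n) (module_vec TYPE('a) m)"
    and "x \<in> carrier_vec n" "y \<in> carrier_vec n"
  shows "\<phi> (x, y) \<in> carrier_vec m"
proof -
  have "linear_vec n m (\<lambda>u. \<phi> (u, y))" using assms by (simp add: bilinear_maps_vec_iff)
  from linear_vecD(1)[OF this assms(2)] show ?thesis .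
qed

text \<open>The three families of forms enter the argument only through these properties, so one
  proof serves them all; \<epsilon> records which symmetrisation of the test forms stays in the
  family.\<close>

definition form_class :: "nat \<Rightarrow> nat \<Rightarrow> 'a::field \<Rightarrow> ('a vec \<times> 'a vec \<Rightarrow> 'a vec) set \<Rightarrow> bool" where
  "form_class n m \<epsilon> B \<longleftrightarrow>
    B \<subseteq> bilinear_maps class_ring (module_vec TYPE('a) n) (module_vec TYPE('a) m) \<and>
    (\<forall>\<phi>\<in>B. \<forall>\<psi>\<in>B. (\<lambda>p \<in> carrier_vec n \<times> carrier_vec n. \<phi> p + \<psi> p) \<in> B) \<and>
    (\<forall>s Y w S c. (\<forall>(i, j)\<in>S. Y i \<in> carrier_vec n \<and> Y j \<in> carrier_vec n) \<longrightarrow>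
      sum_form n m s \<epsilon> Y w S c \<in> B)"

lemma linear_vec_add:
  assumes "linear_vec n m f" and "linear_vec n m g"
  shows "linear_vec n m (\<lambda>x. f x + (g x :: 'a::field vec))"
proof -
  have eq: "(a + b) + (c + d) = (a + c) + (b + d)"
    if "a \<in> carrier_vec m" "b \<in> carrier_vec m" "c \<in> carrier_vec m" "d \<in> carrier_vec m"
    for a b c d :: "'a vec"
    using that by (intro eq_vecI) auto
  show ?thesis
    using assms unfolding linear_vec_def
    by (auto simp: Pi_iff eq smult_add_distrib_vec)
qed

lemma linear_vec_cong:
  assumes "\<And>x. x \<in> carrier_vec n \<Longrightarrow> f x = g x"
  shows "linear_vec n m f = linear_vec n m g"
  using assms unfolding linear_vec_def by (auto simp: Pi_iff)

lemma bilinear_maps_add: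
  fixes \<phi> \<psi> :: "'a::field vec \<times> 'a vec \<Rightarrow> 'a vec"
  assumes "\<phi> \<in> bilinear_maps class_ring (module_vec TYPE('a) n) (module_vec TYPE('a) m)"
    and "\<psi> \<in> bilinear_maps class_ring (module_vec TYPE('a) n) (module_vec TYPE('a) m)"
  shows "(\<lambda>p \<in> carrier_vec n \<times> carrier_vec n. \<phi> p + \<psi> p)
    \<in> bilinear_maps class_ring (module_vec TYPE('a) n) (module_vec TYPE('a) m)"
proof -
  have "linear_vec n m (\<lambda>u. \<phi> (u, v) + \<psi> (u, v))" "linear_vec n m (\<lambda>u. \<phi> (v, u) + \<psi> (v, u))"
    if "v \<in> carrier_vec n" for v
    using assms that by (auto simp: bilinear_maps_vec_iff intro!: linear_vec_add)
  then show ?thesis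
    by (auto simp: bilinear_maps_vec_iff cong: linear_vec_cong)
qed

lemma sum_form_bilinear:
  fixes Y :: "nat \<Rightarrow> 'a::field vec"
  assumes "\<forall>(i, j)\<in>S. Y i \<in> carrier_vec n \<and> Y j \<in> carrier_vec n"
  shows "sum_form n m s \<epsilon> Y w S c \<in> bilinear_maps class_ring (module_vec TYPE('a) n) (module_vec TYPE('a) m)"
proof -
  have "sum_form n m s \<epsilon> Y w S c \<in> extensional (carrier_vec n \<times> carrier_vec n)"
    unfolding sum_form_def by simp
  then show ?thesis
    using assms by (auto simp: bilinear_maps_vec_iff intro!: sum_form_linear)
qed

lemma form_class_bilinear:
  "form_class n m \<epsilon> (bilinear_maps class_ring (module_vec TYPE('a::field) n) (module_vec TYPE('a) m))"
  unfolding form_class_def by (auto intro: bilinear_maps_add sum_form_bilinear)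

text \<open>Exchanging the arguments exchanges the two summands of
  \<open>pair_coeff 1\<close>.\<close>

lemma form_class_symmetric:
  "form_class n m 1 (symmetric_maps class_ring (module_vec TYPE('a::field) n) (module_vec TYPE('a) m))"
proof -
  have "sum_form n m s 1 Y w S c (x, y) = sum_form n m s 1 Y w S c (y, x)"
    if "x \<in> carrier_vec n" "y \<in> carrier_vec n"
    for s w S c x y and Y :: "nat \<Rightarrow> 'a vec"
    using that by (simp add: sum_form_apply pair_coeff_def case_prod_beta add.commute mult.commute)
  then show ?thesis
    unfolding form_class_def symmetric_maps_def
    by (auto simp: module_vec_simps intro: bilinear_maps_add sum_form_bilinear)
qed

text \<open>On the diagonal the two summands of \<open>pair_coeff (- 1)\<close> cancel, in
  characteristic 2 as well.\<close>

lemma form_class_alternating: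
  "form_class n m (- 1) (alternating_maps class_ring (module_vec TYPE('a::field) n) (module_vec TYPE('a) m))"
proof -
  have "sum_form n m s (- 1) Y w S c (x, x) = 0\<^sub>v m" if "x \<in> carrier_vec n"
    for s w S c x and Y :: "nat \<Rightarrow> 'a vec"
    using that by (auto simp: sum_form_apply pair_coeff_def intro!: lin_comb_zero sum.neutral)
  then show ?thesis
    unfolding form_class_def alternating_maps_def
    by (auto simp: module_vec_simps intro: bilinear_maps_add sum_form_bilinear)
qed

text \<open>The automorphism condition with \<open>Q\<close> moved to the other side, which avoids
  its inverse; \<open>bilinear_Aut_iff\<close> justifies this.\<close>

definition fixed_forms ::
  "nat \<Rightarrow> ('a vec \<times> 'a vec \<Rightarrow> 'a vec) set \<Rightarrow> ('a vec \<Rightarrow> 'a vec) \<Rightarrow> ('a vec \<Rightarrow> 'a vec) \<Rightarrow>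
    ('a vec \<times> 'a vec \<Rightarrow> 'a vec) set" where
  "fixed_forms n B P Q =
    {\<phi> \<in> B. \<forall>x\<in>carrier_vec n. \<forall>y\<in>carrier_vec n. \<phi> (P x, P y) = Q (\<phi> (x, y))}"

lemma finite_bilinear_maps:
  "finite (bilinear_maps class_ring (module_vec TYPE('a::{field,finite}) n) (module_vec TYPE('a) m))"
proof (rule finite_subset)
  show "bilinear_maps class_ring (module_vec TYPE('a::{field,finite}) n) (module_vec TYPE('a) m)
    \<subseteq> PiE (carrier_vec n \<times> carrier_vec n) (\<lambda>_. carrier_vec m)"
    by (auto simp: PiE_def bilinear_maps_carrier) (simp add: bilinear_maps_vec_iff)
qed (simp add: finite_PiE)

text \<open>The translates of the group of fixed forms by the members of the family are pairwise disjoint.\<close>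

lemma card_fixed_forms_le:
  fixes B :: "('a::{field,finite} vec \<times> 'a vec \<Rightarrow> 'a vec) set"
  assumes B: "form_class n m \<epsilon> B"
    and P: "linear_vec n n P" and Q: "linear_vec m m Q"
    and S: "finite S" and Y: "\<forall>(i, j)\<in>S. Y i \<in> carrier_vec n \<and> Y j \<in> carrier_vec n"
    and inj: "\<And>c p l. \<lbrakk>\<forall>x\<in>carrier_vec n. \<forall>y\<in>carrier_vec n.
        sum_form n m s \<epsilon> Y w S c (P x, P y) = Q (sum_form n m s \<epsilon> Y w S c (x, y)); p \<in> S; l < s\<rbrakk>
      \<Longrightarrow> c (p, l) = 0"
  shows "card (fixed_forms n B P Q) * CARD('a) ^ (card S * s) \<le> card B"
proof -
  let ?V = "carrier_vec n :: 'a vec set"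
  let ?F = "sum_form n m s \<epsilon> Y w S"
  let ?C = "PiE (S \<times> {..<s}) (\<lambda>_. UNIV :: 'a set)"
  let ?T = "\<lambda>(f, c). \<lambda>p \<in> ?V \<times> ?V. f p + ?F c p"
  have bil: "B \<subseteq> bilinear_maps class_ring (module_vec TYPE('a) n) (module_vec TYPE('a) m)"
    using B unfolding form_class_def by blast
  have car: "f (x, y) \<in> carrier_vec m" if "f \<in> B" "x \<in> ?V" "y \<in> ?V" for f x y
    using bil that by (blast intro: bilinear_maps_carrier)
  have PV: "P x \<in> ?V" if "x \<in> ?V" for x using linear_vecD(1)[OF P that] .
  have "inj_on ?T (fixed_forms n B P Q \<times> ?C)"
  proof (rule inj_onI, clarify)
    fix f c f' c'
    assume f: "f \<in> fixed_forms n B P Q" and f': "f' \<in> fixed_forms n B P Q"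
      and c: "c \<in> ?C" "c' \<in> ?C"
      and eq: "(\<lambda>p \<in> ?V \<times> ?V. f p + ?F c p) = (\<lambda>p \<in> ?V \<times> ?V. f' p + ?F c' p)"
    have fB: "f \<in> B" "f' \<in> B" using f f' by (auto simp: fixed_forms_def)
    \<comment> \<open>If two translates coincide, the test form of \<open>c - c'\<close> is a
      difference of two fixed forms. It is then fixed itself, as \<open>Q\<close> is linear, and
      \<open>inj\<close> forces its coefficients to vanish.\<close>
    have diff: "?F (\<lambda>p. c p - c' p) (x, y) = f' (x, y) - f (x, y)" if xy: "x \<in> ?V" "y \<in> ?V" for x y
    proof -
      have e: "f (x, y) + ?F c (x, y) = f' (x, y) + ?F c' (x, y)"
        using fun_cong[OF eq, of "(x, y)"] xy by simp
      have *: "a - b = d' - d" if "d + a = d' + b" "a \<in> carrier_vec m" "b \<in> carrier_vec m"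
        "d \<in> carrier_vec m" "d' \<in> carrier_vec m" for a b d d' :: "'a vec"
      proof (rule eq_vecI)
        fix t assume "t < dim_vec (d' - d)"
        then have t: "t < m" using that by simp
        have "d $ t + a $ t = d' $ t + b $ t" using arg_cong[OF that(1), of "\<lambda>v. v $ t"] that(2-5) t by simp
        then show "(a - b) $ t = (d' - d) $ t" using that t by (simp add: algebra_simps)
      qed (use that in auto)
      show ?thesis
        unfolding sum_form_diff[OF xy] using *[OF e] car fB xy by (simp add: sum_form_carrier)
    qed
    have "?F (\<lambda>p. c p - c' p) (P x, P y) = Q (?F (\<lambda>p. c p - c' p) (x, y))"
      if xy: "x \<in> ?V" "y \<in> ?V" for x y
      using f f' xy PV diff[OF xy] diff[OF PV PV, OF xy] linear_vec_minus[OF Q] car fB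
      by (simp add: fixed_forms_def)
    then have "c (p, l) - c' (p, l) = 0" if "p \<in> S" "l < s" for p l
      using inj[of "\<lambda>p. c p - c' p"] that by blast
    then have cc: "c = c'" using c by (intro PiE_ext[of c _ _ c']) auto
    have "f p = f' p" if "p \<in> ?V \<times> ?V" for p
    proof -
      obtain x y where p: "p = (x, y)" by (cases p)
      have xy: "x \<in> ?V" "y \<in> ?V" using that p by auto
      have "f (x, y) + ?F c (x, y) = f' (x, y) + ?F c (x, y)"
        using fun_cong[OF eq, of "(x, y)"] xy cc by simp
      moreover have "a = b" if "a + d = b + d" "a \<in> carrier_vec m" "b \<in> carrier_vec m" "d \<in> carrier_vec m"
        for a b d :: "'a vec"
        using vec_eq_iff[THEN iffD1, OF that(1)] that(2-4) by (intro eq_vecI) auto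
      ultimately show ?thesis
        using car fB xy sum_form_carrier[OF xy] unfolding p by blast
    qed
    moreover have "f \<in> extensional (?V \<times> ?V)" "f' \<in> extensional (?V \<times> ?V)"
      using fB bil by (auto simp: bilinear_maps_vec_iff)
    ultimately show "f = f' \<and> c = c'" using cc extensionalityI by blast
  qed
  moreover have "?T ` (fixed_forms n B P Q \<times> ?C) \<subseteq> B"
  proof clarify
    fix f c
    assume "f \<in> fixed_forms n B P Q"
    then show "(\<lambda>p \<in> ?V \<times> ?V. f p + ?F c p) \<in> B"
      using B Y unfolding form_class_def fixed_forms_def by blast
  qed
  moreover have "finite B" using bil finite_bilinear_maps finite_subset by blast
  ultimately have "card (fixed_forms n B P Q \<times> ?C) \<le> card B"
    by (rule card_inj_on_le)
  then show ?thesis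
    using S by (simp add: card_cartesian_product card_PiE)
qed

section \<open>Linear maps close to scalars\<close>

lemma smult_vec_cancel:
  fixes v :: "'a::field vec"
  assumes "v \<in> carrier_vec n" and "v \<noteq> 0\<^sub>v n" and "a \<cdot>\<^sub>v v = b \<cdot>\<^sub>v v"
  shows "a = b"
proof -
  obtain t where "t < n" "v $ t \<noteq> 0" using assms(1,2) by (metis carrier_vecD eq_vecI index_zero_vec)
  then show ?thesis using arg_cong[OF assms(3), of "\<lambda>v. v $ t"] assms(1) by simp
qed

text \<open>The analogue for pairs of maps of the fact that a linear map with every vector as an
  eigenvector is scalar. The vectors \<open>z0\<close> and \<open>z1\<close> say that the image of
  \<open>g\<close> has dimension at least 2.\<close>

lemma pointwise_proportional:
  fixes f g :: "'a::field vec \<Rightarrow> 'a vec"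
  assumes f: "linear_vec n m f" and g: "linear_vec n m g"
    and ptw: "\<And>v. \<lbrakk>v \<in> carrier_vec n; g v \<noteq> 0\<^sub>v m\<rbrakk> \<Longrightarrow> \<exists>a. f v = a \<cdot>\<^sub>v g v"
    and z: "z0 \<in> carrier_vec n" "z1 \<in> carrier_vec n" "g z0 \<noteq> 0\<^sub>v m" "\<And>a. g z1 \<noteq> a \<cdot>\<^sub>v g z0"
  shows "\<exists>a. \<forall>v\<in>carrier_vec n. f v = a \<cdot>\<^sub>v g v"
proof -
  note fD = linear_vecD[OF f] and gD = linear_vecD[OF g]
  obtain a where a: "f z0 = a \<cdot>\<^sub>v g z0" using ptw z by blast
  \<comment> \<open>When \<open>g y\<close> is off the line of \<open>g z0\<close>, the factors at
    \<open>y\<close>, \<open>z0\<close> and \<open>y + z0\<close> must agree by comparing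
    coefficients.\<close>
  have gen: "f y = a \<cdot>\<^sub>v g y" if y: "y \<in> carrier_vec n" and ny: "\<And>b. g y \<noteq> b \<cdot>\<^sub>v g z0" for y
  proof -
    have nz: "g y \<noteq> 0\<^sub>v m"
    proof
      assume "g y = 0\<^sub>v m"
      moreover have "0 \<cdot>\<^sub>v g z0 = 0\<^sub>v m" using gD(1)[OF z(1)] by (intro eq_vecI) auto
      ultimately show False using ny[of 0] by simp
    qed
    have nz': "g (y + z0) \<noteq> 0\<^sub>v m"
    proof
      assume "g (y + z0) = 0\<^sub>v m"
      then have e: "g y + g z0 = 0\<^sub>v m" using gD y z by simp
      have "g y = (- 1) \<cdot>\<^sub>v g z0"
      proof (rule eq_vecI)
        fix t assume "t < dim_vec ((- 1) \<cdot>\<^sub>v g z0)"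
        then have t: "t < m" using gD(1)[OF z(1)] by simp
        have "g y $ t + g z0 $ t = 0"
          using arg_cong[OF e, of "\<lambda>v. v $ t"] t gD(1)[OF z(1)] gD(1)[OF y] by simp
        then show "g y $ t = ((- 1) \<cdot>\<^sub>v g z0) $ t"
          using t gD(1)[OF z(1)] by (simp add: eq_neg_iff_add_eq_0)
      qed (use gD(1)[OF z(1)] gD(1)[OF y] in auto)
      then show False using ny by blast
    qed
    obtain b where b: "f y = b \<cdot>\<^sub>v g y" using ptw[OF y nz] by blast
    obtain d where d: "f (y + z0) = d \<cdot>\<^sub>v g (y + z0)"
      using ptw[OF _ nz'] y z by auto
    have e: "b \<cdot>\<^sub>v g y + a \<cdot>\<^sub>v g z0 = d \<cdot>\<^sub>v (g y + g z0)"
      using d a b fD(2)[OF y z(1)] gD(2)[OF y z(1)] by simp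
    have cmp: "(b - d) * g y $ t = (d - a) * g z0 $ t" if "t < m" for t
      using arg_cong[OF e, of "\<lambda>v. v $ t"] that gD(1)[OF z(1)] gD(1)[OF y]
      by (simp add: algebra_simps)
    have "b = d"
    proof (rule ccontr)
      assume "b \<noteq> d"
      then have "g y = ((d - a) / (b - d)) \<cdot>\<^sub>v g z0"
        using gD(1)[OF z(1)] gD(1)[OF y] cmp by (intro eq_vecI) (auto simp: field_simps)
      then show False using ny by blast
    qed
    moreover have "d = a"
    proof -
      have "d \<cdot>\<^sub>v g z0 = a \<cdot>\<^sub>v g z0"
        using gD(1)[OF z(1)] cmp \<open>b = d\<close> by (intro eq_vecI) (auto simp: algebra_simps)
      then show ?thesis using smult_vec_cancel[OF gD(1)[OF z(1)] z(3)] by blast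
    qed
    ultimately show ?thesis using b by simp
  qed
  \<comment> \<open>On that line, the kernel of \<open>g\<close> included, shift by
    \<open>z1\<close>: the previous case covers both \<open>z1\<close> and
    \<open>z1 + y\<close>.\<close>
  have "f y = a \<cdot>\<^sub>v g y" if y: "y \<in> carrier_vec n" and b: "g y = b \<cdot>\<^sub>v g z0" for y b
  proof -
    have ne: "g (z1 + y) \<noteq> d \<cdot>\<^sub>v g z0" for d
    proof
      assume e: "g (z1 + y) = d \<cdot>\<^sub>v g z0"
      have "g z1 = (d - b) \<cdot>\<^sub>v g z0"
      proof (rule eq_vecI)
        fix t assume "t < dim_vec ((d - b) \<cdot>\<^sub>v g z0)"
        then have t: "t < m" using gD(1)[OF z(1)] by simp
        show "g z1 $ t = ((d - b) \<cdot>\<^sub>v g z0) $ t"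
          using arg_cong[OF e, of "\<lambda>v. v $ t"] t b gD(1)[OF z(1)] gD(1)[OF z(2)] gD(1)[OF y] gD(2)[OF z(2) y]
          by (simp add: algebra_simps)
      qed (use gD(1)[OF z(1)] gD(1)[OF z(2)] in auto)
      then show False using z(4) by blast
    qed
    have e: "f z1 + f y = a \<cdot>\<^sub>v (g z1 + g y)"
      using gen[OF _ ne] y z fD(2)[OF z(2) y] gD(2)[OF z(2) y] by simp
    have e1: "f z1 = a \<cdot>\<^sub>v g z1" using gen z by blast
    show ?thesis
    proof (rule eq_vecI)
      fix t assume "t < dim_vec (a \<cdot>\<^sub>v g y)"
      then have t: "t < m" using gD(1)[OF y] by simp
      show "f y $ t = (a \<cdot>\<^sub>v g y) $ t"
        using arg_cong[OF e, of "\<lambda>v. v $ t"] e1 t gD(1)[OF z(2)] gD(1)[OF y] fD(1)[OF y]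
        by (simp add: algebra_simps)
    qed (use gD(1)[OF y] fD(1)[OF y] in auto)
  qed
  then show ?thesis using gen by blast
qed

text \<open>The vectors and their images under \<open>P\<close> alternate, so that a further pair is
  appended by two extensions of the dual system.\<close>

definition moves :: "nat \<Rightarrow> nat \<Rightarrow> ('a::field vec \<Rightarrow> 'a vec) \<Rightarrow> bool" where
  "moves n k P \<longleftrightarrow> (\<exists>X Y. dual_system n (2 * k) X Y \<and> (\<forall>i<k. X (2 * i + 1) = P (X (2 * i))))"

text \<open>In other words, \<open>f - a\<close> has rank at most \<open>r\<close>, witnessed by
  \<open>r\<close> vectors whose span contains its image.\<close>

definition near_scalar :: "nat \<Rightarrow> nat \<Rightarrow> 'a::field \<Rightarrow> ('a vec \<Rightarrow> 'a vec) \<Rightarrow> bool" where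
  "near_scalar n r a f \<longleftrightarrow> linear_vec n n f \<and>
    (\<exists>U. (\<forall>i<r. U i \<in> carrier_vec n) \<and>
      (\<forall>v\<in>carrier_vec n. \<exists>c. f v = a \<cdot>\<^sub>v v + lin_comb n r c U))"

lemma near_scalar_mono:
  assumes "near_scalar n r a f" and "r \<le> s"
  shows "near_scalar n s a f"
proof -
  obtain U where f: "linear_vec n n f" and U: "\<forall>i<r. U i \<in> carrier_vec n"
    and *: "\<forall>v\<in>carrier_vec n. \<exists>c. f v = a \<cdot>\<^sub>v v + lin_comb n r c U"
    using assms(1) unfolding near_scalar_def by blast
  define U' where "U' = (\<lambda>i. if i < r then U i else 0\<^sub>v n)"
  have "lin_comb n s c U' = lin_comb n r c U" for c
  proof (rule eq_vecI)
    fix t assume "t < dim_vec (lin_comb n r c U)"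
    then have t: "t < n" by simp
    have "(\<Sum>i<s. c i * U' i $ t) = (\<Sum>i<r. c i * U i $ t)"
      using assms(2) t by (intro sum.mono_neutral_cong_right) (auto simp: U'_def)
    then show "lin_comb n s c U' $ t = lin_comb n r c U $ t" using t by simp
  qed simp
  moreover have "\<forall>i<s. U' i \<in> carrier_vec n" using U by (auto simp: U'_def)
  ultimately show ?thesis using f * unfolding near_scalar_def by metis
qed

text \<open>Work modulo the span of \<open>k\<close> moved pairs. For \<open>v\<close> outside this
  span, \<open>P v\<close> lies in the span of \<open>X\<close> and \<open>v\<close>, as otherwise
  \<open>v\<close> and \<open>P v\<close> would form another pair. So \<open>P\<close> sends each
  class to a multiple of itself, with one common factor \<open>a\<close>, and \<open>P - a\<close>
  maps into the span of the \<open>2 * k\<close> vectors.\<close>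

lemma moves_Suc_or_near_scalar:
  fixes P :: "'a::{field,finite} vec \<Rightarrow> 'a vec"
  assumes P: "linear_vec n n P" and n: "2 * k + 2 \<le> n"
    and mk: "moves n k P" and nmk: "\<not> moves n (Suc k) P"
  shows "\<exists>a. near_scalar n (2 * k) a P"
proof -
  obtain X Y where D: "dual_system n (2 * k) X Y" and XP: "\<forall>i<k. X (2 * i + 1) = P (X (2 * i))"
    using mk unfolding moves_def by blast
  note DD = dual_systemD[OF D] and PD = linear_vecD[OF P]
  let ?V = "carrier_vec n :: 'a vec set"
  \<comment> \<open>The projection with the span of \<open>X\<close> as its kernel stands in for the
    quotient map.\<close>
  define pr where "pr v = v - lin_comb n (2 * k) (\<lambda>i. Y i \<bullet> v) X" for v
  have pr_lin: "linear_vec n n pr"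
    unfolding linear_vec_def
  proof (intro conjI ballI allI)
    show "pr \<in> ?V \<rightarrow> ?V" by (auto simp: pr_def)
  next
    fix x y :: "'a vec" assume xy: "x \<in> ?V" "y \<in> ?V"
    have "lin_comb n (2 * k) (\<lambda>i. Y i \<bullet> (x + y)) X =
        lin_comb n (2 * k) (\<lambda>i. Y i \<bullet> x) X + lin_comb n (2 * k) (\<lambda>i. Y i \<bullet> y) X"
      unfolding lin_comb_add[symmetric]
      using DD(2) xy by (intro lin_comb_cong) (auto simp: scalar_prod_add_distrib[of _ n])
    then show "pr (x + y) = pr x + pr y"
      using xy by (intro eq_vecI) (auto simp: pr_def algebra_simps)
  next
    fix a and x :: "'a vec" assume x: "x \<in> ?V"
    have "lin_comb n (2 * k) (\<lambda>i. Y i \<bullet> (a \<cdot>\<^sub>v x)) X = a \<cdot>\<^sub>v lin_comb n (2 * k) (\<lambda>i. Y i \<bullet> x) X"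
      unfolding lin_comb_smult[symmetric]
      using DD(2) x by (intro lin_comb_cong) auto
    then show "pr (a \<cdot>\<^sub>v x) = a \<cdot>\<^sub>v pr x"
      using x by (intro eq_vecI) (auto simp: pr_def algebra_simps)
  qed
  note prD = linear_vecD[OF pr_lin]
  have pr_span: "pr (lin_comb n (2 * k) c X) = 0\<^sub>v n" for c
  proof -
    have "lin_comb n (2 * k) (\<lambda>i. Y i \<bullet> lin_comb n (2 * k) c X) X = lin_comb n (2 * k) c X"
      using dual_system_coeff[OF D] by (intro lin_comb_cong) auto
    then show ?thesis by (simp add: pr_def)
  qed
  have pr0: "v = lin_comb n (2 * k) (\<lambda>i. Y i \<bullet> v) X" if "v \<in> ?V" "pr v = 0\<^sub>v n" for v
  proof (rule eq_vecI)
    fix t assume "t < dim_vec (lin_comb n (2 * k) (\<lambda>i. Y i \<bullet> v) X)"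
    then show "v $ t = lin_comb n (2 * k) (\<lambda>i. Y i \<bullet> v) X $ t"
      using arg_cong[OF that(2), of "\<lambda>v. v $ t"] that(1) by (simp add: pr_def)
  qed (use that in auto)
  have ptw: "\<exists>a. (\<lambda>v. pr (P v)) v = a \<cdot>\<^sub>v pr v" if v: "v \<in> ?V" and nz: "pr v \<noteq> 0\<^sub>v n" for v
  proof -
    have "v \<noteq> lin_comb n (2 * k) (\<lambda>i. Y i \<bullet> v) X"
    proof
      assume "v = lin_comb n (2 * k) (\<lambda>i. Y i \<bullet> v) X"
      then have "pr v = 0\<^sub>v n" using pr_span by metis
      then show False using nz by simp
    qed
    then obtain Y' where D': "dual_system n (Suc (2 * k)) (X(2 * k := v)) Y'"
      using dual_system_extend[OF D v] by blast
    have Pv: "P v = lin_comb n (Suc (2 * k)) (\<lambda>i. Y' i \<bullet> P v) (X(2 * k := v))"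
    proof (rule ccontr)
      assume "P v \<noteq> lin_comb n (Suc (2 * k)) (\<lambda>i. Y' i \<bullet> P v) (X(2 * k := v))"
      then obtain Y'' where "dual_system n (Suc (Suc (2 * k))) (X(2 * k := v, Suc (2 * k) := P v)) Y''"
        using dual_system_extend[OF D' PD(1)[OF v]] by blast
      moreover have "\<forall>i<Suc k. (X(2 * k := v, Suc (2 * k) := P v)) (2 * i + 1) =
          P ((X(2 * k := v, Suc (2 * k) := P v)) (2 * i))"
        using XP by (auto simp: less_Suc_eq)
      ultimately have "moves n (Suc k) P"
        unfolding moves_def by (intro exI conjI) auto
      then show False using nmk by blast
    qed
    define d where "d = (\<lambda>i. Y' i \<bullet> P v)"
    have "P v = lin_comb n (2 * k) d (X(2 * k := v)) + d (2 * k) \<cdot>\<^sub>v v"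
      using Pv v unfolding d_def[symmetric] by (subst (asm) lin_comb_Suc) auto
    moreover have "lin_comb n (2 * k) d (X(2 * k := v)) = lin_comb n (2 * k) d X"
      by (rule lin_comb_cong) auto
    ultimately have "pr (P v) = pr (lin_comb n (2 * k) d X) + pr (d (2 * k) \<cdot>\<^sub>v v)"
      using prD(2) v by simp
    then have "pr (P v) = d (2 * k) \<cdot>\<^sub>v pr v"
      using prD v pr_span by simp
    then show ?thesis by blast
  qed
  have prP: "linear_vec n n (\<lambda>v. pr (P v))"
    using PD prD unfolding linear_vec_def by auto
  have cardV: "CARD('a) ^ n \<le> card ?V" by (simp add: card_carrier_vec)
  \<comment> \<open>In a completed basis the members \<open>2 * k\<close> and
    \<open>2 * k + 1\<close> serve as \<open>z0\<close> and \<open>z1\<close>; they exist because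
    the quotient has dimension at least 2.\<close>
  obtain X' Y' where E: "dual_system n n X' Y'" and X': "\<forall>i<2 * k. X' i = X i"
    using dual_system_extend_within[OF D subset_refl _ cardV] n by auto
  have E2: "dual_system n (2 * k + 2) X' Y'" using dual_system_mono[OF E] n by blast
  have lcX: "lin_comb n (2 * k) c X' = lin_comb n (2 * k) c X" for c
    using X' by (intro lin_comb_cong) auto
  have car: "X' (2 * k) \<in> ?V" "X' (2 * k + 1) \<in> ?V" using dual_systemD[OF E2] by auto
  \<comment> \<open>The functionals with these two indices vanish on the span of \<open>X\<close>,
    so they do not distinguish \<open>pr v\<close> from \<open>v\<close>. They therefore show that
    the two projections are independent.\<close>
  have Yspan: "Y' j \<bullet> lin_comb n (2 * k) c X = 0" if "2 * k \<le> j" "j < 2 * k + 2" for j c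
    unfolding lcX[symmetric] using dual_systemD[OF E2] that by (subst scalar_prod_lin_comb) auto
  have Ypr: "Y' j \<bullet> pr v = Y' j \<bullet> v" if "2 * k \<le> j" "j < 2 * k + 2" "v \<in> ?V" for j v
    using Yspan[OF that(1,2)] dual_systemD(2)[OF E2] that
    by (simp add: pr_def scalar_prod_minus_distrib[of _ n])
  have Y0: "Y' (2 * k) \<in> ?V" "Y' (2 * k + 1) \<in> ?V" using dual_systemD(2)[OF E2] by auto
  have z0: "pr (X' (2 * k)) \<noteq> 0\<^sub>v n"
  proof
    assume "pr (X' (2 * k)) = 0\<^sub>v n"
    then have "Y' (2 * k) \<bullet> X' (2 * k) = 0" using Ypr[of "2 * k", OF _ _ car(1)] Y0 by simp
    then show False using dual_systemD(3)[OF E2, of "2 * k" "2 * k"] by simp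
  qed
  have z1: "pr (X' (2 * k + 1)) \<noteq> a \<cdot>\<^sub>v pr (X' (2 * k))" for a
  proof
    assume "pr (X' (2 * k + 1)) = a \<cdot>\<^sub>v pr (X' (2 * k))"
    then have "Y' (2 * k + 1) \<bullet> X' (2 * k + 1) = a * (Y' (2 * k + 1) \<bullet> X' (2 * k))"
      using Ypr[of "2 * k + 1", OF _ _ car(1)] Ypr[of "2 * k + 1", OF _ _ car(2)] Y0 prD(1) car by simp
    then show False
      using dual_systemD(3)[OF E2, of "2 * k + 1" "2 * k + 1"] dual_systemD(3)[OF E2, of "2 * k + 1" "2 * k"]
      by simp
  qed
  obtain a where a: "\<And>v. v \<in> ?V \<Longrightarrow> pr (P v) = a \<cdot>\<^sub>v pr v"
    using pointwise_proportional[OF prP pr_lin ptw car z0 z1] by blast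
  have "\<exists>c. P v = a \<cdot>\<^sub>v v + lin_comb n (2 * k) c X" if v: "v \<in> ?V" for v
  proof -
    have "pr (P v - a \<cdot>\<^sub>v v) = 0\<^sub>v n"
      using linear_vec_minus[OF pr_lin PD(1)[OF v], of "a \<cdot>\<^sub>v v"] prD v a[OF v] by simp
    then have e: "P v - a \<cdot>\<^sub>v v = lin_comb n (2 * k) (\<lambda>i. Y i \<bullet> (P v - a \<cdot>\<^sub>v v)) X"
      using pr0 PD(1) v by simp
    have "P v = a \<cdot>\<^sub>v v + (P v - a \<cdot>\<^sub>v v)" using PD(1)[OF v] v by (intro eq_vecI) auto
    then show ?thesis using e by metis
  qed
  then show ?thesis using P DD(1) unfolding near_scalar_def by blast
qed

lemma moves_0: "moves n 0 P"
  unfolding moves_def dual_system_def by auto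

text \<open>Add moved pairs one at a time: if this stops at \<open>j < k\<close> pairs, the
  difference from a scalar has rank at most \<open>2 * j\<close>.\<close>

lemma moves_or_near_scalar:
  fixes P :: "'a::{field,finite} vec \<Rightarrow> 'a vec"
  assumes "linear_vec n n P" and "2 * k \<le> n" and "\<not> moves n k P"
  shows "\<exists>a. near_scalar n (2 * (k - 1)) a P"
  using assms(2,3)
proof (induction k)
  case 0
  then show ?case using moves_0 by blast
next
  case (Suc k)
  show ?case
  proof (cases "moves n k P")
    case True
    then show ?thesis using moves_Suc_or_near_scalar[OF assms(1)] Suc.prems by simp
  next
    case False
    then obtain a where "near_scalar n (2 * (k - 1)) a P" using Suc by auto
    then have "near_scalar n (2 * k) a P" by (rule near_scalar_mono) simp
    then show ?thesis by auto
  qed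
qed

section \<open>The proportion of fixed forms\<close>

text \<open>For increasing index pairs the \<epsilon>-summand never contributes, since it would need
  \<open>i = b\<close> and \<open>j = a\<close>. The coefficients can thus be read off in the same
  way in all three families.\<close>

lemma pair_coeff_dual_system:
  assumes D: "dual_system n N X Y" and "i < j" "j < N" "a < b" "b < N"
  shows "pair_coeff \<epsilon> Y (X a) (X b) (i, j) = (if (i, j) = (a, b) then 1 else 0)"
  using assms by (auto simp: pair_coeff_def dual_systemD(3)[OF D])

lemma sum_form_dual_system:
  assumes D: "dual_system n N X Y" and S: "finite S" "S \<subseteq> {(i, j). i < j \<and> j < N}"
    and ab: "(a, b) \<in> S"
  shows "sum_form n m s \<epsilon> Y w S c (X a, X b) = lin_comb m s (\<lambda>l. c ((a, b), l)) w"
proof -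
  have lt: "a < b" "b < N" using S ab by auto
  have "(\<Sum>p\<in>S. pair_coeff \<epsilon> Y (X a) (X b) p * c (p, l)) = c ((a, b), l)" for l
  proof -
    have "(\<Sum>p\<in>S. pair_coeff \<epsilon> Y (X a) (X b) p * c (p, l)) =
        (\<Sum>p\<in>S. if p = (a, b) then c ((a, b), l) else 0)"
    proof (rule sum.cong)
      fix p assume "p \<in> S"
      moreover obtain i j where "p = (i, j)" by (cases p)
      ultimately show "pair_coeff \<epsilon> Y (X a) (X b) p * c (p, l) = (if p = (a, b) then c ((a, b), l) else 0)"
        using S(2) pair_coeff_dual_system[OF D _ _ lt] by auto
    qed simp
    then show ?thesis using S(1) ab by simp
  qed
  then show ?thesis
    using dual_systemD(1)[OF D] lt by (simp add: sum_form_apply)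
qed

text \<open>Both summands of each product contain a functional evaluated at \<open>X a\<close> whose
  index differs from \<open>a\<close>; hence \<open>X a\<close> lies in the radical of the
  form.\<close>

lemma sum_form_dual_system_zero:
  assumes D: "dual_system n N X Y" and S: "S \<subseteq> {(i, j). i < N \<and> j < N \<and> i \<noteq> a \<and> j \<noteq> a}"
    and a: "a < N" and y: "y \<in> carrier_vec n"
  shows "sum_form n m s \<epsilon> Y w S c (X a, y) = 0\<^sub>v m"
proof -
  have "pair_coeff \<epsilon> Y (X a) y p = 0" if "p \<in> S" for p
    using that S a dual_systemD(3)[OF D] by (auto simp: pair_coeff_def)
  then show ?thesis
    using dual_systemD(1)[OF D a] y by (simp add: sum_form_apply lin_comb_zero)
qed

text \<open>The test forms have every \<open>v = X (2 * i)\<close> with \<open>i < k\<close> in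
  their radical but detect \<open>P v\<close>. A fixed test form satisfies
  \<open>F (P v, P y) = Q (F (v, y)) = 0\<close> for all \<open>y\<close>, which kills its
  coefficients as \<open>P\<close> is onto.\<close>

lemma card_fixed_forms_moves:
  fixes B :: "('a::{field,finite} vec \<times> 'a vec \<Rightarrow> 'a vec) set"
  assumes B: "form_class n m \<epsilon> B"
    and P: "linear_vec n n P" and surj: "P ` carrier_vec n = carrier_vec n" and Q: "linear_vec m m Q"
    and mv: "moves n k P" and n: "2 * k \<le> n"
  shows "card (fixed_forms n B P Q) * CARD('a) ^ (k * (n - 2 * k) * m) \<le> card B"
proof -
  let ?V = "carrier_vec n :: 'a vec set"
  obtain X0 Y0 where D0: "dual_system n (2 * k) X0 Y0" and XP0: "\<forall>i<k. X0 (2 * i + 1) = P (X0 (2 * i))"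
    using mv unfolding moves_def by blast
  have cardV: "CARD('a) ^ n \<le> card ?V" by (simp add: card_carrier_vec)
  obtain X Y where D: "dual_system n n X Y" and X: "\<forall>i<2 * k. X i = X0 i"
    using dual_system_extend_within[OF D0 subset_refl n cardV] by auto
  have XP: "X (2 * i + 1) = P (X (2 * i))" if "i < k" for i
    using XP0 X that by simp
  \<comment> \<open>First indices are the positions of the images under \<open>P\<close>, second
    ones lie beyond all moved pairs; so no index is of the form \<open>2 * i\<close> with
    \<open>i < k\<close>.\<close>
  define S where "S = (\<lambda>i. 2 * i + 1) ` {..<k} \<times> {2 * k..<n}"
  have card_S: "card S = k * (n - 2 * k)"
    unfolding S_def by (simp add: card_cartesian_product card_image inj_on_def)
  have S: "finite S" "S \<subseteq> {(i, j). i < j \<and> j < n}"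
    by (auto simp: S_def)
  have "card (fixed_forms n B P Q) * CARD('a) ^ (card S * m) \<le> card B"
  proof (rule card_fixed_forms_le[OF B P Q S(1), of Y m "unit_vec m"])
    show "\<forall>(i, j)\<in>S. Y i \<in> ?V \<and> Y j \<in> ?V"
      using S(2) dual_systemD(2)[OF D] by fastforce
  next
    fix c p l
    let ?F = "sum_form n m m \<epsilon> Y (unit_vec m) S c"
    assume hfix: "\<forall>x\<in>?V. \<forall>y\<in>?V. ?F (P x, P y) = Q (?F (x, y))" and p: "p \<in> S" and l: "l < m"
    obtain i b where pib: "p = (2 * i + 1, b)" and i: "i < k" and b: "2 * k \<le> b" "b < n"
      using p by (auto simp: S_def)
    have i2: "2 * i < n" using i n by linarith
    have Xb: "X b \<in> P ` ?V" using dual_systemD(1)[OF D b(2)] surj by simp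
    then obtain y where y: "y \<in> ?V" "X b = P y" by blast
    have "S \<subseteq> {(j, b). j < n \<and> b < n \<and> j \<noteq> 2 * i \<and> b \<noteq> 2 * i}"
    proof
      fix u assume "u \<in> S"
      moreover obtain u1 u2 where u: "u = (u1, u2)" by (cases u)
      ultimately obtain j where "u1 = 2 * j + 1" "j < k" "2 * k \<le> u2" "u2 < n"
        by (auto simp: S_def)
      moreover from this have "2 * j + 1 < n" "2 * j + 1 \<noteq> 2 * i" "u2 \<noteq> 2 * i"
        using i n by presburger+
      ultimately show "u \<in> {(j, b). j < n \<and> b < n \<and> j \<noteq> 2 * i \<and> b \<noteq> 2 * i}" using u by auto
    qed
    then have "?F (X (2 * i), y) = 0\<^sub>v m"
      using sum_form_dual_system_zero[OF D _ i2 y(1)] by blast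
    then have "?F (P (X (2 * i)), P y) = 0\<^sub>v m"
      using hfix y(1) dual_systemD(1)[OF D i2] linear_vec_zero[OF Q] by simp
    then have "?F (X (2 * i + 1), X b) = 0\<^sub>v m"
      using XP[OF i] y(2) by simp
    moreover have "?F (X (2 * i + 1), X b) = lin_comb m m (\<lambda>l. c ((2 * i + 1, b), l)) (unit_vec m)"
      using sum_form_dual_system[OF D S] p pib by blast
    ultimately have "lin_comb m m (\<lambda>l. c (p, l)) (unit_vec m) = 0\<^sub>v m" using pib by simp
    moreover have "lin_comb m m (\<lambda>l. c (p, l)) (unit_vec m) = vec m (\<lambda>l. c (p, l))"
      by (intro eq_vecI) (auto simp: if_distrib cong: if_cong)
    ultimately show "c (p, l) = 0" using l by (metis index_vec index_zero_vec(1))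
  qed
  then show ?thesis using card_S by simp
qed

text \<open>In other words, \<open>Q - a\<close> has rank at least \<open>s\<close>: it maps the
  \<open>w l\<close> to the independent vectors \<open>Z l\<close>.\<close>

definition moved_by :: "nat \<Rightarrow> nat \<Rightarrow> 'a::field \<Rightarrow> ('a vec \<Rightarrow> 'a vec) \<Rightarrow> bool" where
  "moved_by m s a Q \<longleftrightarrow> (\<exists>w Z Y. dual_system m s Z Y \<and>
    (\<forall>l<s. w l \<in> carrier_vec m \<and> Q (w l) = a \<cdot>\<^sub>v w l + Z l))"

text \<open>The rank of \<open>Q - a\<close>, obtained as the largest \<open>s\<close> with
  \<open>moved_by\<close>. By maximality the vectors \<open>Z l\<close> span the image of
  \<open>Q - a\<close>.\<close>

lemma moved_by_near_scalar:
  fixes Q :: "'a::{field,finite} vec \<Rightarrow> 'a vec"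
  assumes Q: "linear_vec m m Q"
  shows "\<exists>s\<le>m. moved_by m s a Q \<and> near_scalar m s a Q"
proof -
  have "moved_by m 0 a Q" by (auto simp: moved_by_def dual_system_def)
  moreover have bound: "s \<le> m" if "moved_by m s a Q" for s
    using that dual_system_size unfolding moved_by_def by blast
  ultimately obtain s where s: "moved_by m s a Q" and max: "\<And>t. moved_by m t a Q \<Longrightarrow> t \<le> s"
    using Greatest_le_nat[of "\<lambda>s. moved_by m s a Q" _ m] GreatestI_nat[of "\<lambda>s. moved_by m s a Q" 0 m]
    by blast
  obtain w Z Y where D: "dual_system m s Z Y"
    and w: "\<forall>l<s. w l \<in> carrier_vec m \<and> Q (w l) = a \<cdot>\<^sub>v w l + Z l"
    using s unfolding moved_by_def by blast
  have "\<exists>c. Q v = a \<cdot>\<^sub>v v + lin_comb m s c Z" if v: "v \<in> carrier_vec m" for v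
  proof -
    define z where "z = Q v - a \<cdot>\<^sub>v v"
    have z: "z \<in> carrier_vec m" using v linear_vecD(1)[OF Q v] by (simp add: z_def)
    have Qv: "Q v = a \<cdot>\<^sub>v v + z"
      using linear_vecD(1)[OF Q v] v by (intro eq_vecI) (auto simp: z_def)
    have "z = lin_comb m s (\<lambda>i. Y i \<bullet> z) Z"
    proof (rule ccontr)
      assume "z \<noteq> lin_comb m s (\<lambda>i. Y i \<bullet> z) Z"
      then obtain Y' where D': "dual_system m (Suc s) (Z(s := z)) Y'"
        using dual_system_extend[OF D z] by blast
      have "\<forall>l<Suc s. (w(s := v)) l \<in> carrier_vec m \<and> Q ((w(s := v)) l) = a \<cdot>\<^sub>v (w(s := v)) l + (Z(s := z)) l"
        using w v Qv by (auto simp: less_Suc_eq)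
      then have "moved_by m (Suc s) a Q" using D' unfolding moved_by_def by blast
      then show False using max by force
    qed
    then show ?thesis using Qv by metis
  qed
  then have "near_scalar m s a Q"
    using Q dual_systemD(1)[OF D] unfolding near_scalar_def by blast
  then show ?thesis using s bound by blast
qed

text \<open>Rank-nullity by counting: \<open>P - a\<close> takes at most \<open>q ^ r\<close>
  values, and subtracting a point of a nonempty fibre maps that fibre into the eigenspace.\<close>

lemma card_eigenspace_ge:
  fixes P :: "'a::{field,finite} vec \<Rightarrow> 'a vec"
  assumes ns: "near_scalar n r a P"
  shows "CARD('a) ^ n \<le> CARD('a) ^ r * card {v \<in> carrier_vec n. P v = a \<cdot>\<^sub>v v}"
proof -
  let ?V = "carrier_vec n :: 'a vec set"
  let ?K = "{v \<in> ?V. P v = a \<cdot>\<^sub>v v}"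
  obtain U where P: "linear_vec n n P" and U: "\<forall>v\<in>?V. \<exists>c. P v = a \<cdot>\<^sub>v v + lin_comb n r c U"
    using ns unfolding near_scalar_def by blast
  define f where "f v = P v - a \<cdot>\<^sub>v v" for v
  let ?R = "range (\<lambda>c. lin_comb n r c U)"
  have R: "finite ?R" "card ?R \<le> CARD('a) ^ r" using card_lin_comb_le by auto
  have fR: "f ` ?V \<subseteq> ?R"
  proof
    fix z assume "z \<in> f ` ?V"
    then obtain v c where v: "v \<in> ?V" "z = f v" "P v = a \<cdot>\<^sub>v v + lin_comb n r c U" using U by blast
    have "z = lin_comb n r c U" unfolding v(2) f_def v(3) using v(1) by (intro eq_vecI) auto
    then show "z \<in> ?R" by blast
  qed
  have fib: "card {v \<in> ?V. f v = z} \<le> card ?K" if "z \<in> ?R" for z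
  proof (cases "{v \<in> ?V. f v = z} = {}")
    case True
    show ?thesis unfolding True by simp
  next
    case False
    then obtain v0 where v0: "v0 \<in> ?V" "f v0 = z" by blast
    show ?thesis
    proof (rule card_inj_on_le[where f = "\<lambda>v. v - v0"])
      show "inj_on (\<lambda>v. v - v0) {v \<in> ?V. f v = z}"
      proof (rule inj_onI)
        fix x y assume "x \<in> {v \<in> ?V. f v = z}" "y \<in> {v \<in> ?V. f v = z}" and e: "x - v0 = y - v0"
        then have xy: "x \<in> ?V" "y \<in> ?V" by auto
        show "x = y"
        proof (rule eq_vecI)
          fix t assume "t < dim_vec y"
          then show "x $ t = y $ t" using arg_cong[OF e, of "\<lambda>v. v $ t"] xy v0(1) by simp
        qed (use xy in auto)
      qed
      show "(\<lambda>v. v - v0) ` {v \<in> ?V. f v = z} \<subseteq> ?K"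
      proof
        fix u assume "u \<in> (\<lambda>v. v - v0) ` {v \<in> ?V. f v = z}"
        then obtain v where v: "v \<in> ?V" "f v = z" and u: "u = v - v0" by blast
        have e: "P v - a \<cdot>\<^sub>v v = P v0 - a \<cdot>\<^sub>v v0" using v v0 by (simp add: f_def)
        have PV: "P v \<in> ?V" "P v0 \<in> ?V" using linear_vecD(1)[OF P] v v0 by auto
        have "P v - P v0 = a \<cdot>\<^sub>v (v - v0)"
        proof (rule eq_vecI)
          fix t assume "t < dim_vec (a \<cdot>\<^sub>v (v - v0))"
          then show "(P v - P v0) $ t = (a \<cdot>\<^sub>v (v - v0)) $ t"
            using arg_cong[OF e, of "\<lambda>v. v $ t"] v(1) v0(1) PV by (simp add: algebra_simps)
        qed (use v v0 PV in auto)
        then show "u \<in> ?K" using linear_vec_minus[OF P v(1) v0(1)] u v v0 by simp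
      qed
    qed simp
  qed
  have "?V \<subseteq> (\<Union>z\<in>?R. {v \<in> ?V. f v = z})" using fR by blast
  moreover have "finite (\<Union>z\<in>?R. {v \<in> ?V. f v = z})"
    by (rule finite_subset[of _ ?V]) auto
  ultimately have "card ?V \<le> card (\<Union>z\<in>?R. {v \<in> ?V. f v = z})"
    by (rule card_mono[rotated])
  also have "\<dots> \<le> (\<Sum>z\<in>?R. card {v \<in> ?V. f v = z})" by (rule card_UN_le[OF R(1)])
  also have "\<dots> \<le> (\<Sum>z\<in>?R. card ?K)" by (rule sum_mono[OF fib])
  also have "\<dots> \<le> CARD('a) ^ r * card ?K" using R(2) by simp
  finally show ?thesis by (simp add: card_carrier_vec)
qed

lemma card_strict_pairs: "card {(i, j). i < j \<and> j < (N::nat)} = N * (N - 1) div 2"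
proof -
  have "{(i, j). i < j \<and> j < N} = (SIGMA j:{..<N}. {..<j}) \<inverse>" by auto
  then have "card {(i, j). i < j \<and> j < N} = card (SIGMA j:{..<N}. {..<j})" by simp
  also have "\<dots> = \<Sum>{..<N}" by simp
  finally have "card {(i, j). i < j \<and> j < N} = \<Sum>{..<N}" .
  moreover have "2 * \<Sum>{..<N} = N * (N - 1)"
  proof (induction N)
    case (Suc N)
    then show ?case by (cases N) auto
  qed simp
  ultimately show ?thesis by simp
qed

text \<open>A fixed form sends pairs of \<open>a\<close>-eigenvectors of \<open>P\<close> into the
  kernel of \<open>Q - a * a\<close>. The test forms live on independent eigenvectors and take
  values in the span of the \<open>w l\<close>, on which \<open>Q - a * a\<close> is
  injective.\<close>

lemma card_fixed_forms_near_scalar: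
  fixes B :: "('a::{field,finite} vec \<times> 'a vec \<Rightarrow> 'a vec) set"
  assumes B: "form_class n m \<epsilon> B"
    and P: "near_scalar n r a P" and r: "r \<le> n"
    and Q: "linear_vec m m Q" and mv: "moved_by m s (a * a) Q"
  shows "card (fixed_forms n B P Q) * CARD('a) ^ ((n - r) * (n - r - 1) div 2 * s) \<le> card B"
proof -
  let ?V = "carrier_vec n :: 'a vec set"
  let ?K = "{v \<in> ?V. P v = a \<cdot>\<^sub>v v}"
  have Pl: "linear_vec n n P" using P unfolding near_scalar_def by blast
  obtain w Z Y' where DZ: "dual_system m s Z Y'"
    and w: "\<forall>l<s. w l \<in> carrier_vec m \<and> Q (w l) = (a * a) \<cdot>\<^sub>v w l + Z l"
    using mv unfolding moved_by_def by blast
  have D0: "dual_system n 0 X Y" for X Y :: "nat \<Rightarrow> 'a vec" by (simp add: dual_system_def)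
  \<comment> \<open>Cancelling \<open>q ^ r\<close> leaves at least \<open>q ^ (n - r)\<close>
    eigenvectors, enough for a dual system of \<open>n - r\<close> of them.\<close>
  have "CARD('a) ^ r * CARD('a) ^ (n - r) \<le> CARD('a) ^ r * card ?K"
    using card_eigenspace_ge[OF P] r by (simp flip: power_add)
  then have "CARD('a) ^ (n - r) \<le> card ?K"
    using one_less_card_field[where 'a = 'a] by simp
  then obtain X Y where D: "dual_system n (n - r) X Y" and XK: "\<And>i. i < n - r \<Longrightarrow> X i \<in> ?K"
    using dual_system_extend_within[OF D0, of ?K "n - r"] by auto
  \<comment> \<open>Only increasing pairs: these are the values that can be prescribed independently
    even for alternating forms.\<close>
  define S where "S = {(i, j). i < j \<and> j < n - r}"
  have S: "finite S" "S \<subseteq> {(i, j). i < j \<and> j < n - r}"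
    by (auto simp: S_def intro: finite_subset[of _ "{..<n - r} \<times> {..<n - r}"])
  have YV: "\<forall>(i, j)\<in>S. Y i \<in> ?V \<and> Y j \<in> ?V"
    using S(2) dual_systemD(2)[OF D] by fastforce
  have "card (fixed_forms n B P Q) * CARD('a) ^ (card S * s) \<le> card B"
  proof (rule card_fixed_forms_le[OF B Pl Q S(1) YV])
    fix c p l
    let ?F = "sum_form n m s \<epsilon> Y w S c"
    assume hfix: "\<forall>x\<in>?V. \<forall>y\<in>?V. ?F (P x, P y) = Q (?F (x, y))" and p: "p \<in> S" and l: "l < s"
    obtain i j where pij: "p = (i, j)" by (cases p)
    have ij: "i < n - r" "j < n - r" using p by (auto simp: S_def pij)
    have K: "X i \<in> ?V" "P (X i) = a \<cdot>\<^sub>v X i" "X j \<in> ?V" "P (X j) = a \<cdot>\<^sub>v X j"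
      using XK[OF ij(1)] XK[OF ij(2)] by auto
    have F: "?F (X i, X j) = lin_comb m s (\<lambda>l. c (p, l)) w"
      using sum_form_dual_system[OF D S] p pij by blast
    have aX: "a \<cdot>\<^sub>v X j \<in> ?V" using K by simp
    have "?F (P (X i), P (X j)) = (a * a) \<cdot>\<^sub>v ?F (X i, X j)"
      using K linear_vecD(3)[OF sum_form_linear(1)[OF YV aX] K(1)]
        linear_vecD(3)[OF sum_form_linear(2)[OF YV K(1)] K(3)]
      by (simp add: smult_smult_assoc)
    moreover have "?F (P (X i), P (X j)) = Q (?F (X i, X j))" using hfix K(1,3) by blast
    ultimately have e: "Q (lin_comb m s (\<lambda>l. c (p, l)) w) = (a * a) \<cdot>\<^sub>v lin_comb m s (\<lambda>l. c (p, l)) w"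
      unfolding F by simp
    \<comment> \<open>Applying \<open>Q - a * a\<close> replaces each \<open>w l\<close> by
      \<open>Z l\<close>; the resulting combination is zero, and the functionals \<open>Y'\<close>
      return its coefficients.\<close>
    have "Q (lin_comb m s (\<lambda>l. c (p, l)) w) = lin_comb m s (\<lambda>l. c (p, l)) (\<lambda>l. Q (w l))"
      using w by (intro linear_vec_lin_comb[OF Q]) simp
    also have "\<dots> = lin_comb m s (\<lambda>l. c (p, l)) (\<lambda>l. (a * a) \<cdot>\<^sub>v w l + Z l)"
      using w by (intro lin_comb_cong) auto
    also have "\<dots> = (a * a) \<cdot>\<^sub>v lin_comb m s (\<lambda>l. c (p, l)) w + lin_comb m s (\<lambda>l. c (p, l)) Z"
    proof (rule eq_vecI)
      fix t assume "t < dim_vec ((a * a) \<cdot>\<^sub>v lin_comb m s (\<lambda>l. c (p, l)) w + lin_comb m s (\<lambda>l. c (p, l)) Z)"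
      then have t: "t < m" by simp
      have "((a * a) \<cdot>\<^sub>v w l + Z l) $ t = a * a * w l $ t + Z l $ t" if "l < s" for l
      proof -
        have "w l \<in> carrier_vec m" "Z l \<in> carrier_vec m" using w that dual_systemD(1)[OF DZ that] by auto
        then show ?thesis using t by simp
      qed
      then have "(\<Sum>l<s. c (p, l) * ((a * a) \<cdot>\<^sub>v w l + Z l) $ t) =
          (\<Sum>l<s. a * a * (c (p, l) * w l $ t) + c (p, l) * Z l $ t)"
        by (intro sum.cong) (simp_all add: distrib_left mult_ac)
      also have "\<dots> = a * a * (\<Sum>l<s. c (p, l) * w l $ t) + (\<Sum>l<s. c (p, l) * Z l $ t)"
        by (simp only: sum.distrib sum_distrib_left)
      finally show "lin_comb m s (\<lambda>l. c (p, l)) (\<lambda>l. (a * a) \<cdot>\<^sub>v w l + Z l) $ t =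
        ((a * a) \<cdot>\<^sub>v lin_comb m s (\<lambda>l. c (p, l)) w + lin_comb m s (\<lambda>l. c (p, l)) Z) $ t"
        using t by simp
    qed simp
    finally have e2: "(a * a) \<cdot>\<^sub>v lin_comb m s (\<lambda>l. c (p, l)) w =
      (a * a) \<cdot>\<^sub>v lin_comb m s (\<lambda>l. c (p, l)) w + lin_comb m s (\<lambda>l. c (p, l)) Z"
      using e by simp
    have "lin_comb m s (\<lambda>l. c (p, l)) Z = 0\<^sub>v m"
    proof (rule eq_vecI)
      fix t assume "t < dim_vec (0\<^sub>v m :: 'a vec)"
      then have t: "t < m" by simp
      then show "lin_comb m s (\<lambda>l. c (p, l)) Z $ t = 0\<^sub>v m $ t"
        using arg_cong[OF e2, of "\<lambda>v. v $ t"] by simp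
    qed simp
    then show "c (p, l) = 0"
      using dual_system_coeff[OF DZ l, of "\<lambda>l. c (p, l)"] dual_systemD(2)[OF DZ l] by simp
  qed
  then show ?thesis unfolding S_def card_strict_pairs .
qed

text \<open>Such a map is determined by the \<open>r\<close> spanning vectors, with
  \<open>r * n\<close> entries, and by the \<open>n * r\<close> coefficients of \<open>f - a\<close>
  on the unit vectors.\<close>

lemma card_near_scalar_le:
  "finite {f \<in> extensional (carrier_vec n). near_scalar n r (a :: 'a::{field,finite}) f} \<and>
   card {f \<in> extensional (carrier_vec n). near_scalar n r a f} \<le> CARD('a) ^ (2 * r * n)"
proof -
  let ?V = "carrier_vec n :: 'a vec set"
  let ?N = "{f \<in> extensional ?V. near_scalar n r a f}"
  let ?T = "PiE {..<r} (\<lambda>_. ?V) \<times> PiE ({..<n} \<times> {..<r}) (\<lambda>_. UNIV :: 'a set)"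
  define G where "G = (\<lambda>(U, c). \<lambda>v\<in>?V. lin_comb n n (\<lambda>i. v $ i)
      (\<lambda>i. a \<cdot>\<^sub>v unit_vec n i + lin_comb n r (\<lambda>j. c (i, j)) U))"
  have sub: "?N \<subseteq> G ` ?T"
  proof
    fix f assume f: "f \<in> ?N"
    then obtain U where fl: "linear_vec n n f" and fe: "f \<in> extensional ?V"
      and U: "\<forall>i<r. U i \<in> ?V"
      and *: "\<forall>v\<in>?V. \<exists>c. f v = a \<cdot>\<^sub>v v + lin_comb n r c U"
      unfolding near_scalar_def by blast
    have "\<forall>i. \<exists>c. i < n \<longrightarrow> f (unit_vec n i) = a \<cdot>\<^sub>v unit_vec n i + lin_comb n r c U"
      using * unit_vec_carrier by blast
    then obtain c where c: "\<And>i. i < n \<Longrightarrow> f (unit_vec n i) = a \<cdot>\<^sub>v unit_vec n i + lin_comb n r (c i) U"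
      using choice[of "\<lambda>i c. i < n \<longrightarrow> f (unit_vec n i) = a \<cdot>\<^sub>v unit_vec n i + lin_comb n r c U"] by blast
    let ?U = "restrict U {..<r}" and ?c = "\<lambda>(i, j) \<in> {..<n} \<times> {..<r}. c i j"
    have "f = G (?U, ?c)"
    proof (rule extensionalityI[OF fe])
      show "G (?U, ?c) \<in> extensional ?V" by (simp add: G_def)
    next
      fix v assume v: "v \<in> ?V"
      have "f v = f (lin_comb n n (\<lambda>i. v $ i) (unit_vec n))" using lin_comb_unit_vec[OF v] by simp
      also have "\<dots> = lin_comb n n (\<lambda>i. v $ i) (\<lambda>i. f (unit_vec n i))"
        by (rule linear_vec_lin_comb[OF fl]) simp
      also have "\<dots> = lin_comb n n (\<lambda>i. v $ i)
          (\<lambda>i. a \<cdot>\<^sub>v unit_vec n i + lin_comb n r (\<lambda>j. ?c (i, j)) ?U)"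
      proof (rule lin_comb_cong)
        fix i assume i: "i < n"
        have "lin_comb n r (c i) U = lin_comb n r (\<lambda>j. ?c (i, j)) ?U"
          using i by (intro lin_comb_cong) auto
        then show "f (unit_vec n i) = a \<cdot>\<^sub>v unit_vec n i + lin_comb n r (\<lambda>j. ?c (i, j)) ?U"
          using c[OF i] by simp
      qed simp
      also have "\<dots> = G (?U, ?c) v" using v by (simp add: G_def)
      finally show "f v = G (?U, ?c) v" .
    qed
    moreover have "(?U, ?c) \<in> ?T" using U by auto
    ultimately show "f \<in> G ` ?T" by blast
  qed
  have fin: "finite ?T" by (intro finite_cartesian_product finite_PiE) auto
  have "card (PiE {..<r} (\<lambda>_. ?V)) = (CARD('a) ^ n) ^ r"
    by (simp add: card_PiE card_carrier_vec)
  moreover have "card (PiE ({..<n} \<times> {..<r}) (\<lambda>_. UNIV :: 'a set)) = CARD('a) ^ (n * r)"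
    by (simp add: card_PiE)
  ultimately have "card ?T = (CARD('a) ^ n) ^ r * CARD('a) ^ (n * r)"
    by (simp only: card_cartesian_product)
  also have "\<dots> = CARD('a) ^ (2 * r * n)"
    unfolding power_mult[symmetric] power_add[symmetric] by (rule arg_cong[where f = "(^) _"]) simp
  finally have "card ?T = CARD('a) ^ (2 * r * n)" .
  then have "card (G ` ?T) \<le> CARD('a) ^ (2 * r * n)"
    using card_image_le[OF fin, of G] by (rule ord_le_eq_trans[rotated])
  then have "card ?N \<le> CARD('a) ^ (2 * r * n)"
    by (rule le_trans[OF card_mono[OF finite_imageI[OF fin] sub]])
  then show ?thesis using finite_subset[OF sub finite_imageI[OF fin]] by (rule conjI[rotated])
qed

section \<open>Averages\<close>

lemma GL_vec_iff:
  "P \<in> GL (class_ring :: 'a::field ring) (module_vec TYPE('a) n) \<longleftrightarrow>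
    P \<in> extensional (carrier_vec n) \<and> linear_vec n n P \<and> bij_betw P (carrier_vec n) (carrier_vec n)"
  unfolding GL_def by (auto simp: module_vec_simps module_hom_vec_iff)

text \<open>With this trivial rank bound, \<open>card_near_scalar_le\<close> also bounds the general
  linear group. The exponent \<open>2 * n * n\<close> so obtained is crude, which the choice of
  \<open>k\<close> compensates.\<close>

lemma linear_near_scalar:
  fixes f :: "'a::field vec \<Rightarrow> 'a vec"
  assumes "linear_vec n n f"
  shows "near_scalar n n a f"
  unfolding near_scalar_def
proof (intro conjI exI[of _ "unit_vec n"] allI impI ballI)
  fix v :: "'a vec" assume v: "v \<in> carrier_vec n"
  have z: "f v - a \<cdot>\<^sub>v v \<in> carrier_vec n" using linear_vecD(1)[OF assms v] v by simp
  have "f v = a \<cdot>\<^sub>v v + (f v - a \<cdot>\<^sub>v v)"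
    using linear_vecD(1)[OF assms v] v by (intro eq_vecI) auto
  then show "\<exists>c. f v = a \<cdot>\<^sub>v v + lin_comb n n c (unit_vec n)"
    using lin_comb_unit_vec[OF z] by metis
qed (use assms in auto)

lemma near_scalar_0_iff:
  "near_scalar n 0 a f \<longleftrightarrow> linear_vec n n f \<and> (\<forall>v\<in>carrier_vec n. f v = a \<cdot>\<^sub>v v)"
proof -
  have "a \<cdot>\<^sub>v v + lin_comb n 0 c U = a \<cdot>\<^sub>v v" if "v \<in> carrier_vec n" for v c U
    using that by (simp add: lin_comb_zero)
  then show ?thesis unfolding near_scalar_def by auto
qed

lemma bilinear_Aut_iff:
  fixes \<phi> :: "'a::field vec \<times> 'a vec \<Rightarrow> 'a vec"
  assumes \<phi>: "\<phi> \<in> bilinear_maps class_ring (module_vec TYPE('a) n) (module_vec TYPE('a) m)"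
  shows "(P, Q) \<in> bilinear_Aut class_ring (module_vec TYPE('a) n) (module_vec TYPE('a) m) \<phi> \<longleftrightarrow>
    P \<in> GL class_ring (module_vec TYPE('a) n) \<and> Q \<in> GL class_ring (module_vec TYPE('a) m) \<and>
    (\<forall>x\<in>carrier_vec n. \<forall>y\<in>carrier_vec n. \<phi> (P x, P y) = Q (\<phi> (x, y)))"
proof -
  let ?V = "carrier_vec n :: 'a vec set" and ?W = "carrier_vec m :: 'a vec set"
  have "bilinear_act (module_vec TYPE('a) n) (module_vec TYPE('a) m) (P, Q) \<phi> = \<phi> \<longleftrightarrow>
      (\<forall>x\<in>?V. \<forall>y\<in>?V. \<phi> (P x, P y) = Q (\<phi> (x, y)))"
    if P: "P \<in> GL class_ring (module_vec TYPE('a) n)" and Q: "Q \<in> GL class_ring (module_vec TYPE('a) m)"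
  proof -
    have PV: "P x \<in> ?V" if "x \<in> ?V" for x using P that by (auto simp: GL_vec_iff bij_betw_def)
    have Qb: "bij_betw Q ?W ?W" using Q by (simp add: GL_vec_iff)
    have inv: "inv_into ?W Q z = u \<longleftrightarrow> z = Q u" if "z \<in> ?W" "u \<in> ?W" for z u
      using Qb that by (metis bij_betw_def bij_betw_inv_into_left f_inv_into_f)
    have ext: "\<phi> \<in> extensional (?V \<times> ?V)" using \<phi> by (simp add: bilinear_maps_vec_iff)
    let ?\<psi> = "bilinear_act (module_vec TYPE('a) n) (module_vec TYPE('a) m) (P, Q) \<phi>"
    have \<psi>: "?\<psi> \<in> extensional (?V \<times> ?V)"
      by (simp add: bilinear_act_def module_vec_simps)
    have "?\<psi> (x, y) = inv_into ?W Q (\<phi> (P x, P y))" if "x \<in> ?V" "y \<in> ?V" for x y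
      using that by (simp add: bilinear_act_def module_vec_simps)
    moreover have "?\<psi> = \<phi> \<longleftrightarrow> (\<forall>p\<in>?V \<times> ?V. ?\<psi> p = \<phi> p)"
      using extensionalityI[OF \<psi> ext] by metis
    ultimately have "?\<psi> = \<phi> \<longleftrightarrow> (\<forall>x\<in>?V. \<forall>y\<in>?V. inv_into ?W Q (\<phi> (P x, P y)) = \<phi> (x, y))"
      by simp
    also have "\<dots> \<longleftrightarrow> (\<forall>x\<in>?V. \<forall>y\<in>?V. \<phi> (P x, P y) = Q (\<phi> (x, y)))"
      using inv bilinear_maps_carrier[OF \<phi>] PV by blast
    finally show ?thesis .
  qed
  then show ?thesis unfolding bilinear_Aut_def by auto
qed

lemma finite_GL:
  "finite (GL class_ring (module_vec TYPE('a::{field,finite}) n)) \<and>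
   card (GL class_ring (module_vec TYPE('a) n)) \<le> CARD('a) ^ (2 * n * n)"
proof -
  have sub: "GL class_ring (module_vec TYPE('a) n) \<subseteq> {f \<in> extensional (carrier_vec n). near_scalar n n 0 f}"
    by (auto simp: GL_vec_iff linear_near_scalar)
  note N = card_near_scalar_le[of n n "0 :: 'a"]
  show ?thesis
    using finite_subset[OF sub] card_mono[OF _ sub] N by (blast intro: le_trans)
qed

text \<open>Double counting of the triples of a form and a pair \<open>(P, Q)\<close> that fixes
  it.\<close>

lemma average_Aut_eq:
  fixes B :: "('a::{field,finite} vec \<times> 'a vec \<Rightarrow> 'a vec) set"
  assumes B: "B \<subseteq> bilinear_maps class_ring (module_vec TYPE('a) n) (module_vec TYPE('a) m)"
  shows "average_Aut class_ring (module_vec TYPE('a) n) (module_vec TYPE('a) m) B =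
    (\<Sum>(P, Q) \<in> GL class_ring (module_vec TYPE('a) n) \<times> GL class_ring (module_vec TYPE('a) m).
      real (card (fixed_forms n B P Q)) / real (card B))"
proof -
  let ?G = "GL class_ring (module_vec TYPE('a) n) \<times> GL class_ring (module_vec TYPE('a) m)"
  let ?R = "\<lambda>\<phi> PQ. \<forall>x\<in>carrier_vec n. \<forall>y\<in>carrier_vec n. \<phi> (fst PQ x, fst PQ y) = snd PQ (\<phi> (x, y))"
  have finG: "finite ?G" using finite_GL by blast
  have finB: "finite B" using B finite_bilinear_maps finite_subset by blast
  have Aut: "bilinear_Aut class_ring (module_vec TYPE('a) n) (module_vec TYPE('a) m) \<phi> = {PQ \<in> ?G. ?R \<phi> PQ}"
    if "\<phi> \<in> B" for \<phi>
    using bilinear_Aut_iff[OF subsetD[OF B that]] by auto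
  have "(\<Sum>\<phi>\<in>B. real (card (bilinear_Aut class_ring (module_vec TYPE('a) n) (module_vec TYPE('a) m) \<phi>))) =
      (\<Sum>\<phi>\<in>B. \<Sum>PQ\<in>?G. if ?R \<phi> PQ then 1 else 0)"
    using finG by (intro sum.cong) (simp_all add: Aut sum.If_cases Int_def)
  also have "\<dots> = (\<Sum>PQ\<in>?G. \<Sum>\<phi>\<in>B. if ?R \<phi> PQ then 1 else 0)" by (rule sum.swap)
  also have "\<dots> = (\<Sum>(P, Q)\<in>?G. real (card (fixed_forms n B P Q)))"
    using finB by (intro sum.cong) (auto simp: fixed_forms_def sum.If_cases Int_def)
  finally show ?thesis
    unfolding average_Aut_def by (simp add: sum_divide_distrib case_prod_beta)
qed

section \<open>The union bound over all pairs of maps\<close>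

lemma sum_UN_le:
  fixes f :: "'b \<Rightarrow> real"
  assumes "finite I" and "\<And>i. i \<in> I \<Longrightarrow> finite (A i)" and "\<And>x. 0 \<le> f x"
  shows "sum f (\<Union>i\<in>I. A i) \<le> (\<Sum>i\<in>I. sum f (A i))"
  using assms(1,2)
proof (induction I)
  case (insert i I)
  have "sum f (A i \<union> (\<Union>i\<in>I. A i)) \<le> sum f (A i) + sum f (\<Union>i\<in>I. A i)"
    using sum_Un[of "A i" "\<Union>i\<in>I. A i" f] insert assms(3) by (simp add: sum_nonneg)
  then show ?case using insert by simp
qed simp

text \<open>The exponents are subtracted as reals, since the interesting case is
  \<open>b > a\<close>.\<close>

lemma sum_le_card_powr:
  fixes f :: "'b \<Rightarrow> real" and q :: nat
  assumes "card A \<le> q ^ a" and "\<And>x. x \<in> A \<Longrightarrow> f x \<le> real q powr - real b" and "0 < q"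
  shows "sum f A \<le> real q powr (real a - real b)"
proof -
  have "sum f A \<le> real (card A) * (real q powr - real b)"
    using sum_bounded_above[of A f, OF assms(2)] by simp
  also have "\<dots> \<le> real (q ^ a) * (real q powr - real b)"
    using assms(1) by (intro mult_right_mono) (simp_all only: of_nat_le_iff powr_ge_zero)
  also have "\<dots> = real q powr (real a - real b)"
    using assms(3) by (simp add: powr_diff powr_minus powr_realpow field_simps)
  finally show ?thesis .
qed

text \<open>The four parts of the bound belong to the sets \<open>E0\<close> to \<open>E3\<close>:
  scalar pairs; \<open>P\<close> with \<open>k\<close> moved pairs; \<open>P\<close> near
  \<open>a\<close> with \<open>Q - a * a\<close> of rank \<open>s > 0\<close>; and \<open>P\<close>
  near \<open>a\<close> but not scalar with \<open>Q = a * a\<close>.\<close>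

lemma average_Aut_le:
  fixes B :: "('a::{field,finite} vec \<times> 'a vec \<Rightarrow> 'a vec) set"
  assumes B: "form_class n m \<epsilon> B" and k: "1 \<le> k" and n: "2 * k + 2 \<le> n"
    and m: "2 * m \<le> (n - 2 * k) * (n - 2 * k - 1) div 2"
  defines "q \<equiv> CARD('a)"
  shows "average_Aut class_ring (module_vec TYPE('a) n) (module_vec TYPE('a) m) B \<le> real q - 1 +
    real q powr (real (2 * n * n + 2 * m * m) - real (k * (n - 2 * k) * m)) +
    real q powr (real (1 + m + 4 * k * n + 2 * m) - real ((n - 2 * k) * (n - 2 * k - 1) div 2)) +
    real q powr (real (1 + 4 * k * n) - real ((n - 2) * m))"
proof -
  let ?Gn = "GL class_ring (module_vec TYPE('a) n)" and ?Gm = "GL class_ring (module_vec TYPE('a) m)"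
  let ?T = "(n - 2 * k) * (n - 2 * k - 1) div 2"
  define \<rho> where "\<rho> = (\<lambda>(P, Q). real (card (fixed_forms n B P Q)) / real (card B))"
  have q: "1 < q" using one_less_card_field[where 'a = 'a] by (simp add: q_def)
  have bil: "B \<subseteq> bilinear_maps class_ring (module_vec TYPE('a) n) (module_vec TYPE('a) m)"
    using B unfolding form_class_def by blast
  have finB: "finite B" using bil finite_bilinear_maps finite_subset by blast
  \<comment> \<open>The family contains the test forms, so the proportions have a nonzero
    denominator.\<close>
  have "\<exists>\<phi>. \<phi> \<in> B" using B unfolding form_class_def by (metis empty_iff)
  then have cardB: "0 < card B" using finB by (auto simp: card_gt_0_iff)
  have \<rho>0: "0 \<le> \<rho> x" for x by (cases x) (simp add: \<rho>_def)
  have \<rho>1: "\<rho> x \<le> 1" for x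
  proof -
    obtain P Q where x: "x = (P, Q)" by (cases x)
    have "card (fixed_forms n B P Q) \<le> card B"
      using finB by (intro card_mono) (auto simp: fixed_forms_def)
    then show ?thesis using cardB by (simp add: \<rho>_def x)
  qed
  have \<rho>le: "\<rho> (P, Q) \<le> real q powr - real e" if "card (fixed_forms n B P Q) * q ^ e \<le> card B" for P Q e
  proof -
    have "real (card (fixed_forms n B P Q)) * real q ^ e \<le> real (card B)"
      using that by (metis of_nat_le_iff of_nat_mult of_nat_power)
    then show ?thesis
      using cardB q by (simp add: \<rho>_def powr_minus powr_realpow field_simps)
  qed
  have GnD: "linear_vec n n P" "P ` carrier_vec n = carrier_vec n" "P \<in> extensional (carrier_vec n)"
    "inj_on P (carrier_vec n)" if "P \<in> ?Gn" for P
    using that by (auto simp: GL_vec_iff bij_betw_def)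
  have GmD: "linear_vec m m Q" "Q \<in> extensional (carrier_vec m)" if "Q \<in> ?Gm" for Q
    using that by (auto simp: GL_vec_iff)
  define E0 where "E0 = (\<lambda>a. (\<lambda>v\<in>carrier_vec n. a \<cdot>\<^sub>v v, \<lambda>v\<in>carrier_vec m. (a * a) \<cdot>\<^sub>v v)) ` (UNIV - {0 :: 'a})"
  define E1 where "E1 = {P \<in> ?Gn. moves n k P} \<times> ?Gm"
  define E2 where "E2 = (\<lambda>(a, s). {P \<in> ?Gn. near_scalar n (2 * k) a P} \<times>
    {Q \<in> ?Gm. near_scalar m s (a * a) Q \<and> moved_by m s (a * a) Q})"
  define E3 where "E3 = (\<lambda>a. {P \<in> ?Gn. near_scalar n (2 * k) a P \<and> moves n 1 P} \<times>
    {Q \<in> ?Gm. near_scalar m 0 (a * a) Q})"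
  have finE: "finite E0" "finite E1" "finite (E2 as)" "finite (E3 a)" for as a
    using finite_GL[where 'a = 'a] by (auto simp: E0_def E1_def E2_def E3_def case_prod_beta)
  have cover: "?Gn \<times> ?Gm \<subseteq> E0 \<union> E1 \<union> (\<Union>as\<in>UNIV \<times> {1..m}. E2 as) \<union> (\<Union>a. E3 a)"
  proof clarify
    fix P Q assume P: "P \<in> ?Gn" and Q: "Q \<in> ?Gm"
      and n3: "(P, Q) \<notin> (\<Union>a. E3 a)" and n2: "(P, Q) \<notin> (\<Union>as\<in>UNIV \<times> {1..m}. E2 as)"
      and n1: "(P, Q) \<notin> E1"
    have nk: "\<not> moves n k P" using n1 P Q by (auto simp: E1_def)
    have "0 < s \<Longrightarrow> s \<le> m \<Longrightarrow> near_scalar n (2 * k) a P \<Longrightarrow> near_scalar m s (a * a) Q \<Longrightarrow>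
      \<not> moved_by m s (a * a) Q" for a s
      using n2 P Q by (force simp: E2_def)
    then have Q0: "near_scalar m 0 (a * a) Q" if "near_scalar n (2 * k) a P" for a
      using moved_by_near_scalar[OF GmD(1)[OF Q], of "a * a"] that by (metis neq0_conv)
    have nm1: "\<not> moves n 1 P"
    proof
      assume m1: "moves n 1 P"
      obtain a where "near_scalar n (2 * (k - 1)) a P"
        using moves_or_near_scalar[OF GnD(1)[OF P] _ nk] n by auto
      then have "near_scalar n (2 * k) a P" by (rule near_scalar_mono) simp
      then show False using n3 m1 P Q Q0 by (auto simp: E3_def)
    qed
    \<comment> \<open>Without even one moved pair, the rank bound \<open>2 * (1 - 1)\<close> makes
      \<open>P\<close> a scalar.\<close>
    then obtain a where a: "near_scalar n 0 a P"
      using moves_or_near_scalar[OF GnD(1)[OF P], of 1] n by auto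
    then have Qa: "near_scalar m 0 (a * a) Q" using Q0 near_scalar_mono by blast
    \<comment> \<open>The zero map is not injective, since \<open>n > 0\<close>.\<close>
    have "a \<noteq> 0"
    proof
      assume "a = 0"
      then have "P (unit_vec n 0) = P (0\<^sub>v n)"
        using a by (auto simp: near_scalar_0_iff)
      then have "unit_vec n 0 = (0\<^sub>v n :: 'a vec)"
        using GnD(4)[OF P] by (auto dest: inj_onD)
      then have "unit_vec n 0 $ 0 = (0\<^sub>v n :: 'a vec) $ 0" by simp
      then show False using n by simp
    qed
    moreover have "P = (\<lambda>v\<in>carrier_vec n. a \<cdot>\<^sub>v v)"
      using a GnD(3)[OF P] by (intro extensionalityI[of P "carrier_vec n"]) (auto simp: near_scalar_0_iff)
    moreover have "Q = (\<lambda>v\<in>carrier_vec m. (a * a) \<cdot>\<^sub>v v)"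
      using Qa GmD(2)[OF Q] by (intro extensionalityI[of Q "carrier_vec m"]) (auto simp: near_scalar_0_iff)
    ultimately show "(P, Q) \<in> E0" by (auto simp: E0_def)
  qed
  have card_ns: "finite {P \<in> GL class_ring (module_vec TYPE('a) N). near_scalar N r a P}"
    "card {P \<in> GL class_ring (module_vec TYPE('a) N). near_scalar N r a P} \<le> q ^ (2 * r * N)" for N r a
  proof -
    have sub: "{P \<in> GL class_ring (module_vec TYPE('a) N). near_scalar N r a P}
        \<subseteq> {f \<in> extensional (carrier_vec N). near_scalar N r a f}"
      by (auto simp: GL_vec_iff)
    show "card {P \<in> GL class_ring (module_vec TYPE('a) N). near_scalar N r a P} \<le> q ^ (2 * r * N)"
      using card_mono[OF _ sub] card_near_scalar_le[of N r a] unfolding q_def by (blast intro: le_trans)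
  qed (use finite_GL[where 'a = 'a] in auto)
  have s0: "sum \<rho> E0 \<le> real q - 1"
  proof -
    have "sum \<rho> E0 \<le> real (card E0)" using sum_bounded_above[of E0 \<rho> 1] \<rho>1 by simp
    also have "card E0 \<le> card (UNIV - {0 :: 'a})" unfolding E0_def by (rule card_image_le) simp
    also have "real (card (UNIV - {0 :: 'a})) = real q - 1"
      using q by (simp add: card_Diff_singleton q_def of_nat_diff)
    finally show ?thesis by simp
  qed
  have s1: "sum \<rho> E1 \<le> real q powr (real (2 * n * n + 2 * m * m) - real (k * (n - 2 * k) * m))"
  proof (rule sum_le_card_powr)
    have "card {P \<in> ?Gn. moves n k P} \<le> card ?Gn"
      using finite_GL[of n, where 'a = 'a] by (intro card_mono) auto
    then have "card {P \<in> ?Gn. moves n k P} \<le> q ^ (2 * n * n)"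
      using finite_GL[of n, where 'a = 'a] unfolding q_def by (meson le_trans)
    then show "card E1 \<le> q ^ (2 * n * n + 2 * m * m)"
      using finite_GL[of m, where 'a = 'a] unfolding E1_def card_cartesian_product power_add q_def
      by (intro mult_le_mono) auto
  next
    fix x assume "x \<in> E1"
    then obtain P Q where x: "x = (P, Q)" and P: "P \<in> ?Gn" "moves n k P" and Q: "Q \<in> ?Gm"
      by (auto simp: E1_def)
    show "\<rho> x \<le> real q powr - real (k * (n - 2 * k) * m)"
      using card_fixed_forms_moves[OF B GnD(1,2)[OF P(1)] GmD(1)[OF Q] P(2)] n
      unfolding x by (intro \<rho>le) (simp add: q_def)
  qed (use q in simp)
  have s2: "sum \<rho> (\<Union>as\<in>UNIV \<times> {1..m}. E2 as) \<le>
    real q powr (real (1 + m + 4 * k * n + 2 * m) - real ?T)"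
  proof -
    have E2: "sum \<rho> (E2 as) \<le> real q powr (real (4 * k * n + 2 * m) - real ?T)" if as_in: "as \<in> UNIV \<times> {1..m}" for as
    proof -
      obtain a s where as: "as = (a, s)" and s: "1 \<le> s" using as_in by (cases as) auto
      have "sum \<rho> (E2 as) \<le> real q powr (real (4 * k * n + 2 * s * m) - real (?T * s))"
      proof (rule sum_le_card_powr)
        have "card {Q \<in> ?Gm. near_scalar m s (a * a) Q \<and> moved_by m s (a * a) Q}
            \<le> card {Q \<in> ?Gm. near_scalar m s (a * a) Q}"
          by (rule card_mono[OF card_ns(1)]) auto
        also note card_ns(2)
        finally have "card (E2 as) \<le> q ^ (2 * (2 * k) * n) * q ^ (2 * s * m)"
          using card_ns(2)[of n "2 * k" a] unfolding E2_def as prod.case card_cartesian_product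
          by (intro mult_le_mono)
        then show "card (E2 as) \<le> q ^ (4 * k * n + 2 * s * m)" by (simp add: power_add)
      next
        fix x assume "x \<in> E2 as"
        then obtain P Q where x: "x = (P, Q)" and P: "P \<in> ?Gn" "near_scalar n (2 * k) a P"
          and Q: "Q \<in> ?Gm" "moved_by m s (a * a) Q"
          by (auto simp: E2_def as)
        show "\<rho> x \<le> real q powr - real (?T * s)"
          using card_fixed_forms_near_scalar[OF B P(2) _ GmD(1)[OF Q(1)] Q(2)] n
          unfolding x by (intro \<rho>le) (simp add: q_def)
      qed (use q in simp)
      also have "\<dots> \<le> real q powr (real (4 * k * n + 2 * m) - real ?T)"
      proof (rule powr_mono)
        \<comment> \<open>Each further unit of rank costs \<open>2 * m\<close> in the number of
          \<open>Q\<close> and gains \<open>?T\<close> in the proportion, so \<open>s = 1\<close> is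
          the worst case.\<close>
        have "2 * m * (s - 1) \<le> ?T * (s - 1)" using m by (rule mult_le_mono1)
        then have "2 * m * s + ?T \<le> ?T * s + 2 * m"
          using s by (cases s) auto
        then have "real (2 * m * s + ?T) \<le> real (?T * s + 2 * m)" by (simp only: of_nat_le_iff)
        then show "real (4 * k * n + 2 * s * m) - real (?T * s) \<le> real (4 * k * n + 2 * m) - real ?T"
          by (simp add: mult_ac)
      qed (use q in simp)
      finally show ?thesis .
    qed
    have "sum \<rho> (\<Union>as\<in>UNIV \<times> {1..m}. E2 as) \<le> (\<Sum>as\<in>UNIV \<times> {1..m}. sum \<rho> (E2 as))"
      using finE(3) \<rho>0 by (intro sum_UN_le) auto
    also have "\<dots> \<le> (\<Sum>as\<in>(UNIV :: 'a set) \<times> {1..m}. real q powr (real (4 * k * n + 2 * m) - real ?T))"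
      by (rule sum_mono[OF E2])
    also have "\<dots> = real (q * m) * real q powr (real (4 * k * n + 2 * m) - real ?T)"
      by (simp add: card_cartesian_product q_def)
    \<comment> \<open>The \<open>q * m\<close> choices of \<open>(a, s)\<close> are absorbed into
      the exponent, at the price of \<open>1 + m\<close>.\<close>
    also have "\<dots> \<le> real (q ^ (1 + m)) * real q powr (real (4 * k * n + 2 * m) - real ?T)"
    proof (intro mult_right_mono)
      have "m < q ^ m" using q by (simp add: power_gt_expt)
      then have "q * m \<le> q ^ (1 + m)" by simp
      then show "real (q * m) \<le> real (q ^ (1 + m))" by (simp only: of_nat_le_iff)
    qed simp
    also have "\<dots> = real q powr (real (1 + m)) * real q powr (real (4 * k * n + 2 * m) - real ?T)"
      using q by (subst powr_realpow) simp_all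
    also have "\<dots> = real q powr (real (1 + m + 4 * k * n + 2 * m) - real ?T)"
      unfolding powr_add[symmetric] by (simp add: algebra_simps)
    finally show ?thesis .
  qed
  have s3: "sum \<rho> (\<Union>a. E3 a) \<le> real q powr (real (1 + 4 * k * n) - real ((n - 2) * m))"
  proof -
    have E3: "sum \<rho> (E3 a) \<le> real q powr (real (4 * k * n) - real ((n - 2) * m))" for a
    proof (rule sum_le_card_powr)
      have "card {P \<in> ?Gn. near_scalar n (2 * k) a P \<and> moves n 1 P}
          \<le> card {P \<in> ?Gn. near_scalar n (2 * k) a P}"
        by (rule card_mono[OF card_ns(1)]) auto
      also note card_ns(2)
      \<comment> \<open>At rank 0 the counting bound leaves at most one \<open>Q\<close>.\<close>
      finally have "card (E3 a) \<le> q ^ (2 * (2 * k) * n) * q ^ (2 * 0 * m)"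
        using card_ns(2)[of m 0 "a * a"] unfolding E3_def card_cartesian_product
        by (intro mult_le_mono)
      then show "card (E3 a) \<le> q ^ (4 * k * n)" by simp
    next
      fix x assume "x \<in> E3 a"
      then obtain P Q where x: "x = (P, Q)" and P: "P \<in> ?Gn" "moves n 1 P" and Q: "Q \<in> ?Gm"
        by (auto simp: E3_def)
      show "\<rho> x \<le> real q powr - real ((n - 2) * m)"
        using card_fixed_forms_moves[OF B GnD(1,2)[OF P(1)] GmD(1)[OF Q] P(2)] n
        unfolding x by (intro \<rho>le) (simp add: q_def)
    qed (use q in simp)
    have "sum \<rho> (\<Union>a. E3 a) \<le> (\<Sum>a\<in>UNIV. sum \<rho> (E3 a))"
      using finE(4) \<rho>0 by (intro sum_UN_le) auto
    also have "\<dots> \<le> (\<Sum>a\<in>(UNIV :: 'a set). real q powr (real (4 * k * n) - real ((n - 2) * m)))"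
      by (rule sum_mono[OF E3])
    also have "\<dots> = real q powr 1 * real q powr (real (4 * k * n) - real ((n - 2) * m))"
      using q by (simp add: q_def)
    also have "\<dots> = real q powr (real (1 + 4 * k * n) - real ((n - 2) * m))"
      unfolding powr_add[symmetric] by (simp add: algebra_simps)
    finally show ?thesis .
  qed
  let ?U2 = "\<Union>as\<in>UNIV \<times> {1..m}. E2 as" and ?U3 = "\<Union>a. E3 a"
  have fin23: "finite ?U2" "finite ?U3" using finE by auto
  have Un: "sum \<rho> (A \<union> A') \<le> sum \<rho> A + sum \<rho> A'" if "finite A" "finite A'" for A A'
    using sum_Un[OF that, of \<rho>] \<rho>0 by (simp add: sum_nonneg)
  have "average_Aut class_ring (module_vec TYPE('a) n) (module_vec TYPE('a) m) B = sum \<rho> (?Gn \<times> ?Gm)"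
    unfolding average_Aut_eq[OF bil] \<rho>_def by (simp add: case_prod_beta)
  also have "\<dots> \<le> sum \<rho> (E0 \<union> E1 \<union> ?U2 \<union> ?U3)"
    using finE fin23 cover \<rho>0 by (intro sum_mono2) auto
  also have "\<dots> \<le> sum \<rho> E0 + sum \<rho> E1 + sum \<rho> ?U2 + sum \<rho> ?U3"
    using Un[of "E0 \<union> E1 \<union> ?U2" ?U3] Un[of "E0 \<union> E1" ?U2] Un[of E0 E1] finE fin23 by simp
  also have "\<dots> \<le> real q - 1 +
    real q powr (real (2 * n * n + 2 * m * m) - real (k * (n - 2 * k) * m)) +
    real q powr (real (1 + m + 4 * k * n + 2 * m) - real ?T) +
    real q powr (real (1 + 4 * k * n) - real ((n - 2) * m))"
    using s0 s1 s2 s3 by linarith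
  finally show ?thesis .
qed

section \<open>Asymptotics\<close>

text \<open>The first bound on \<open>n\<close> gives \<open>|R| \<le> C n / 2\<close>, which also
  keeps the ceiling nonnegative, so that \<open>nat\<close> does not truncate it. The second one
  absorbs \<open>R\<close> and the rounding error into one extra \<open>n\<close>.\<close>

lemma ceiling_linear_bounds:
  fixes C R :: rat
  assumes C: "C > 0" and m: "m = nat \<lceil>C * of_nat n + R\<rceil>"
    and n: "real n \<ge> 2 * \<bar>real_of_rat R\<bar> / real_of_rat C" "real n \<ge> \<bar>real_of_rat R\<bar> + 1"
  shows "real_of_rat C / 2 * real n \<le> real m" and "real m \<le> (real_of_rat C + 1) * real n"
proof -
  define A r where "A = real_of_rat C" and "r = real_of_rat R"
  have A: "A > 0" using C by (simp add: A_def)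
  have x: "real_of_rat (C * of_nat n + R) = A * real n + r"
    by (simp add: A_def r_def of_rat_add of_rat_mult)
  have An: "A * real n \<ge> 2 * \<bar>r\<bar>"
    using n(1) A unfolding A_def[symmetric] r_def[symmetric] by (simp add: field_simps)
  then have "0 \<le> A * real n + r" by linarith
  then have "0 \<le> C * of_nat n + R" unfolding x[symmetric] by simp
  then have m': "int m = \<lceil>C * of_nat n + R\<rceil>" unfolding m by simp
  have "C * of_nat n + R \<le> of_int \<lceil>C * of_nat n + R\<rceil>" "of_int \<lceil>C * of_nat n + R\<rceil> < C * of_nat n + R + 1"
    using ceiling_correct[of "C * of_nat n + R"] by linarith+
  then have "C * of_nat n + R \<le> of_nat m" "of_nat m < C * of_nat n + R + 1"
    unfolding m'[symmetric] by simp_all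
  then have "real_of_rat (C * of_nat n + R) \<le> real_of_rat (of_nat m)"
    "real_of_rat (of_nat m) < real_of_rat (C * of_nat n + R + 1)"
    by (simp_all only: of_rat_less_eq of_rat_less)
  then have mb: "A * real n + r \<le> real m" "real m < A * real n + r + 1"
    by (simp_all only: x of_rat_add[of _ 1] of_rat_of_nat_eq of_rat_1)
  show "real_of_rat C / 2 * real n \<le> real m"
    using mb(1) An unfolding A_def[symmetric] by linarith
  have "(A + 1) * real n = A * real n + real n" by (simp add: algebra_simps)
  then show "real m \<le> (real_of_rat C + 1) * real n"
    using mb(2) n(2) unfolding A_def[symmetric] r_def[symmetric] by linarith
qed

lemma real_choose_pairs: "real (N * (N - 1) div 2) = real N * (real N - 1) / 2"
proof (cases N)
  case (Suc k)
  have "even (N * (N - 1))" using Suc by simp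
  then show ?thesis using Suc by (simp add: real_of_nat_div algebra_simps)
qed simp

text \<open>Here \<open>A\<close> is the slope \<open>C\<close>. The bound on \<open>k\<close> lets
  the gain \<open>k * n * m / 2\<close> outweigh the exponents \<open>2 * n\<^sup>2\<close> and
  \<open>2 * m\<^sup>2\<close> of the general linear groups; the bounds on \<open>n\<close> make
  linear terms small against quadratic ones.\<close>

lemma exponent_bounds:
  fixes A :: real and n m k :: nat
  assumes A: "A > 0" and k: "real k * A / 4 \<ge> 3 + 2 * (A + 1)\<^sup>2"
    and n: "real n \<ge> 16 * (3 + 3 * (A + 1) + 4 * real k)" "real n \<ge> 8 * (1 + 4 * real k) / A"
    and m: "A / 2 * real n \<le> real m" "real m \<le> (A + 1) * real n"
  shows "2 * k + 2 \<le> n" and "2 * m \<le> (n - 2 * k) * (n - 2 * k - 1) div 2"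
    and "real (2 * n * n + 2 * m * m) - real (k * (n - 2 * k) * m) \<le> - (real n)\<^sup>2"
    and "real (1 + m + 4 * k * n + 2 * m) - real ((n - 2 * k) * (n - 2 * k - 1) div 2) \<le> - (1 / 16) * (real n)\<^sup>2"
    and "real (1 + 4 * k * n) - real ((n - 2) * m) \<le> - (A / 8) * (real n)\<^sup>2"
proof -
  define x where "x = real n"
  define K where "K = real k"
  have K0: "K \<ge> 0" by (simp add: K_def)
  have nx: "16 * (3 + 3 * (A + 1) + 4 * K) \<le> x" using n(1) by (simp only: x_def K_def)
  then have "4 * K + 4 \<le> x" using A K0 by (simp add: algebra_simps)
  moreover from this have "1 \<le> x" using K0 by linarith
  ultimately have x1: "4 * K + 4 \<le> x" "1 \<le> x" .
  then have "real (2 * k + 2) \<le> real n" unfolding x_def K_def by simp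
  then show kn: "2 * k + 2 \<le> n" by (simp only: of_nat_le_iff)
  have sub: "real (n - 2 * k) = x - 2 * K" "real (n - 2) = x - 2"
    using kn by (simp_all add: of_nat_diff x_def K_def)
  have m1: "A / 2 * x \<le> real m" and m2: "real m \<le> (A + 1) * x" using m by (simp_all add: x_def)
  have T: "real ((n - 2 * k) * (n - 2 * k - 1) div 2) \<ge> x\<^sup>2 / 8 - x / 4"
  proof -
    \<comment> \<open>As \<open>n \<ge> 4 * k\<close>, at least half of the dimension remains after
      removing \<open>2 * k\<close>.\<close>
    have "(x / 2) * (x / 2 - 1) \<le> (x - 2 * K) * (x - 2 * K - 1)"
      using x1 K0 by (intro mult_mono) auto
    then show ?thesis unfolding real_choose_pairs sub(1) by (simp add: algebra_simps power2_eq_square)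
  qed
  \<comment> \<open>All linear terms together cost at most \<open>x\<^sup>2 / 16\<close>, half of
    the main term in \<open>T\<close>.\<close>
  have lin: "x * (16 * (3 + 3 * (A + 1) + 4 * K)) \<le> x\<^sup>2"
    using nx x1 unfolding power2_eq_square by (intro mult_left_mono) auto
  have pos: "0 \<le> A * x" "0 \<le> K * x" using A K0 x1 by auto
  have "real (2 * m) \<le> real ((n - 2 * k) * (n - 2 * k - 1) div 2)"
    using T m2 lin pos x1 by (simp add: algebra_simps)
  then show "2 * m \<le> (n - 2 * k) * (n - 2 * k - 1) div 2" by (simp only: of_nat_le_iff)
  show "real (1 + m + 4 * k * n + 2 * m) - real ((n - 2 * k) * (n - 2 * k - 1) div 2) \<le> - (1 / 16) * (real n)\<^sup>2"
  proof -
    have e: "real (1 + m + 4 * k * n + 2 * m) = 1 + 3 * real m + 4 * (K * x)"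
      by (simp add: x_def K_def)
    show ?thesis unfolding e x_def[symmetric] using T m2 lin pos x1 by (simp add: algebra_simps)
  qed
  show "real (2 * n * n + 2 * m * m) - real (k * (n - 2 * k) * m) \<le> - (real n)\<^sup>2"
  proof -
    have "real m * real m \<le> ((A + 1) * x) * ((A + 1) * x)"
      using m2 A x1 by (intro mult_mono) auto
    then have mm: "real m * real m \<le> (A + 1)\<^sup>2 * x\<^sup>2" by (simp add: power2_eq_square algebra_simps)
    have "(x / 2) * (A / 2 * x) \<le> (x - 2 * K) * real m"
      using m1 x1 A K0 by (intro mult_mono) auto
    then have "K * ((x / 2) * (A / 2 * x)) \<le> K * ((x - 2 * K) * real m)"
      using K0 by (rule mult_left_mono)
    then have km: "(K * A / 4) * x\<^sup>2 \<le> K * ((x - 2 * K) * real m)"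
      by (simp add: power2_eq_square algebra_simps)
    have "(3 + 2 * (A + 1)\<^sup>2) * x\<^sup>2 \<le> (K * A / 4) * x\<^sup>2"
      using k unfolding K_def[symmetric] by (intro mult_right_mono) auto
    then have k2: "3 * x\<^sup>2 + 2 * ((A + 1)\<^sup>2 * x\<^sup>2) \<le> K * ((x - 2 * K) * real m)"
      using km by (simp add: distrib_right)
    have "real (k * (n - 2 * k) * m) = K * ((x - 2 * K) * real m)"
      unfolding of_nat_mult sub(1) by (simp add: K_def)
    moreover have "real (2 * n * n + 2 * m * m) = 2 * x\<^sup>2 + 2 * (real m * real m)"
      by (simp add: x_def power2_eq_square)
    ultimately show ?thesis using k2 mm unfolding x_def[symmetric] by linarith
  qed
  show "real (1 + 4 * k * n) - real ((n - 2) * m) \<le> - (A / 8) * (real n)\<^sup>2"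
  proof -
    have "(x / 2) * (A / 2 * x) \<le> (x - 2) * real m"
      using m1 x1 A K0 by (intro mult_mono) auto
    then have a: "2 * ((A / 8) * x\<^sup>2) \<le> (x - 2) * real m" by (simp add: power2_eq_square algebra_simps)
    have "8 * (1 + 4 * K) \<le> x * A"
      using n(2) A unfolding x_def[symmetric] K_def[symmetric] by (simp add: field_simps)
    then have "x * (8 * (1 + 4 * K)) \<le> x * (x * A)" using x1 by (intro mult_left_mono) auto
    \<comment> \<open>Half of the quadratic gain pays for the linear terms, and the other half is
      the claimed rate.\<close>
    then have b: "x + 4 * (K * x) \<le> (A / 8) * x\<^sup>2" by (simp add: power2_eq_square algebra_simps)
    have "real (1 + 4 * k * n) = 1 + 4 * (K * x)" by (simp add: x_def K_def)
    moreover have "real ((n - 2) * m) = (x - 2) * real m" unfolding of_nat_mult sub(2) ..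
    ultimately show ?thesis using a b x1 unfolding x_def[symmetric] by linarith
  qed
qed

text \<open>Half of the exponent pays for the factor 3 that arises from the three error
  terms.\<close>

lemma three_powr_le:
  fixes q e :: real
  assumes "2 \<le> q" and "2 \<le> e"
  shows "3 * q powr (- (2 * e)) \<le> q powr (- e)"
proof -
  have "q powr (- e) \<le> q powr (- 2)" using assms by (intro powr_mono) auto
  also have "\<dots> = 1 / (q * q)" using assms by (simp add: powr_minus field_simps power2_eq_square powr_numeral)
  also have "\<dots> \<le> 1 / 3"
    using mult_mono[of 2 q 2 q] assms by (intro divide_left_mono) auto
  finally have "q powr (- e) * q powr (- e) \<le> 1 / 3 * q powr (- e)"
    by (rule mult_right_mono) simp
  moreover have "q powr (- (2 * e)) = q powr (- e) * q powr (- e)"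
    by (simp flip: powr_add)
  ultimately show ?thesis by simp
qed

text \<open>The constants are fixed before \<epsilon> and \<open>B\<close>, so they serve all three
  families at once.\<close>

lemma average_Aut_bound:
  fixes C R :: rat
  assumes C: "C > 0"
  shows "\<exists>c::real. \<exists>n0::nat. c > 0 \<and>
    (\<forall>n\<ge>n0. \<forall>\<epsilon> B. form_class n (nat \<lceil>C * of_nat n + R\<rceil>) (\<epsilon> :: 'a::{field,finite}) B \<longrightarrow>
      average_Aut class_ring (module_vec TYPE('a) n) (module_vec TYPE('a) (nat \<lceil>C * of_nat n + R\<rceil>)) B
        \<le> real CARD('a) - 1 + real CARD('a) powr (- c * (real n)\<^sup>2))"
proof -
  define A where "A = real_of_rat C"
  have A: "A > 0" using C by (simp add: A_def)
  define k where "k = nat \<lceil>4 * (3 + 2 * (A + 1)\<^sup>2) / A\<rceil>"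
  have "4 * (3 + 2 * (A + 1)\<^sup>2) / A \<le> real k" unfolding k_def by (rule real_nat_ceiling_ge)
  then have k: "real k * A / 4 \<ge> 3 + 2 * (A + 1)\<^sup>2" using A by (simp add: field_simps)
  have k1: "1 \<le> k"
  proof (rule ccontr)
    assume "\<not> 1 \<le> k"
    then have "k = 0" by simp
    then have "3 + 2 * (A + 1)\<^sup>2 \<le> 0" using k by simp
    moreover have "0 \<le> (A + 1)\<^sup>2" by simp
    ultimately show False by linarith
  qed
  \<comment> \<open>Half of the smallest of the rates 1, 1/16 and \<open>A / 8\<close> from
    \<open>exponent_bounds\<close>; the other half is spent in \<open>three_powr_le\<close>.\<close>
  define c where "c = min (1 / 32) (A / 16)"
  have c: "c > 0" using A by (simp add: c_def)
  \<comment> \<open>The entry \<open>2 / c\<close> ensures \<open>c * n\<^sup>2 \<ge> 2\<close>; the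
    others are the thresholds of the two preceding estimates.\<close>
  define b where "b = Max {2 / c, 2 * \<bar>real_of_rat R\<bar> / A, \<bar>real_of_rat R\<bar> + 1,
    16 * (3 + 3 * (A + 1) + 4 * real k), 8 * (1 + 4 * real k) / A}"
  define n0 where "n0 = nat \<lceil>b\<rceil>"
  have "average_Aut class_ring (module_vec TYPE('a) n) (module_vec TYPE('a) (nat \<lceil>C * of_nat n + R\<rceil>)) B
        \<le> real CARD('a) - 1 + real CARD('a) powr (- c * (real n)\<^sup>2)"
    if n0: "n \<ge> n0" and B: "form_class n (nat \<lceil>C * of_nat n + R\<rceil>) \<epsilon> B"
    for n and \<epsilon> :: 'a and B
  proof -
    define m where "m = nat \<lceil>C * of_nat n + R\<rceil>"
    have "b \<le> real n" using n0 real_nat_ceiling_ge[of b] unfolding n0_def by linarith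
    then have n: "real n \<ge> 2 / c" "real n \<ge> 2 * \<bar>real_of_rat R\<bar> / A" "real n \<ge> \<bar>real_of_rat R\<bar> + 1"
      "real n \<ge> 16 * (3 + 3 * (A + 1) + 4 * real k)" "real n \<ge> 8 * (1 + 4 * real k) / A"
      unfolding b_def by simp_all
    note mb = ceiling_linear_bounds[OF C m_def n(2)[unfolded A_def] n(3), folded A_def]
    note ex = exponent_bounds[OF A k n(4,5) mb]
    let ?q = "real CARD('a)" and ?e = "c * (real n)\<^sup>2"
    have q: "2 \<le> ?q" using one_less_card_field[where 'a = 'a] by simp
    have "2 * c \<le> 1" "2 * c \<le> 1 / 16" "2 * c \<le> A / 8"
      using min.cobounded1[of "1 / 32" "A / 16"] min.cobounded2[of "1 / 32" "A / 16"]
      unfolding c_def by linarith+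
    then have "2 * c * (real n)\<^sup>2 \<le> 1 * (real n)\<^sup>2" "2 * c * (real n)\<^sup>2 \<le> 1 / 16 * (real n)\<^sup>2"
      "2 * c * (real n)\<^sup>2 \<le> A / 8 * (real n)\<^sup>2"
      by (simp_all only: mult_right_mono zero_le_power2)
    then have ce: "2 * ?e \<le> (real n)\<^sup>2" "2 * ?e \<le> 1 / 16 * (real n)\<^sup>2" "2 * ?e \<le> A / 8 * (real n)\<^sup>2"
      by (simp_all only: mult.assoc mult_1)
    have e2: "2 \<le> ?e"
    proof -
      have "2 \<le> c * real n" using n(1) c by (simp add: field_simps)
      moreover have "1 \<le> real n" using n(3) by linarith
      ultimately have "2 * 1 \<le> (c * real n) * real n" by (intro mult_mono) auto
      then show ?thesis by (simp add: power2_eq_square algebra_simps)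
    qed
    have le: "?q powr u \<le> ?q powr (- (2 * ?e))" if "u \<le> - (2 * ?e)" for u
      using that q by (intro powr_mono) auto
    have "average_Aut class_ring (module_vec TYPE('a) n) (module_vec TYPE('a) m) B \<le> ?q - 1 +
        3 * ?q powr (- (2 * ?e))"
      using average_Aut_le[OF B[folded m_def] k1 ex(1,2)]
        le[of "real (2 * n * n + 2 * m * m) - real (k * (n - 2 * k) * m)"]
        le[of "real (1 + m + 4 * k * n + 2 * m) - real ((n - 2 * k) * (n - 2 * k - 1) div 2)"]
        le[of "real (1 + 4 * k * n) - real ((n - 2) * m)"] ex(3-5) ce
      by linarith
    also have "\<dots> \<le> ?q - 1 + ?q powr (- c * (real n)\<^sup>2)"
      using three_powr_le[OF q e2] by simp
    finally show ?thesis unfolding m_def .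
  qed
  then show ?thesis using c by blast
qed

theorem theorem1p1:
  fixes F :: "'a::{field,finite} itself" and q :: nat and C R :: rat
  assumes q: "q = CARD('a)"
    and C: "C > 0"
  shows "\<exists>c::real. \<exists>n0::nat. c > 0 \<and>
    (\<forall>n\<ge>n0. \<forall>m. m = nat \<lceil>C * of_nat n + R\<rceil> \<longrightarrow>
      h F n m \<le> real q - 1 + real q powr (- c * (real n)\<^sup>2) \<and>
      h_S F n m \<le> real q - 1 + real q powr (- c * (real n)\<^sup>2) \<and>
      h_Alt F n m \<le> real q - 1 + real q powr (- c * (real n)\<^sup>2))"
proof -
  have F: "module_vec F n = module_vec TYPE('a) n" for n by (simp add: module_vec_def)
  obtain c n0 where c: "c > 0"
    and bound: "\<And>n m \<epsilon> B. n \<ge> n0 \<Longrightarrow> m = nat \<lceil>C * of_nat n + R\<rceil> \<Longrightarrow> form_class n m (\<epsilon> :: 'a) B \<Longrightarrow>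
      average_Aut class_ring (module_vec TYPE('a) n) (module_vec TYPE('a) m) B
        \<le> real CARD('a) - 1 + real CARD('a) powr (- c * (real n)\<^sup>2)"
    using average_Aut_bound[OF C, of R, where 'a = 'a] by blast
  \<comment> \<open>For the full family every \<epsilon> is admissible, and 1 is an arbitrary
    choice; the other two families prescribe 1 and -1.\<close>
  show ?thesis
    unfolding q F h_def h_S_def h_Alt_def Let_def
    using c bound[OF _ _ form_class_bilinear[where \<epsilon> = 1]] bound[OF _ _ form_class_symmetric]
      bound[OF _ _ form_class_alternating]
    by (intro exI[of _ c] exI[of _ n0] conjI allI impI) blast+
qed

end
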